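(* Let $m\in\mathbb N$, $\varphi\in L^2(\mathbb R^m,d\gamma)$, $f(x,t)=e^{it\mathscr L}\varphi(x)$, and $s\in\mathbb R$. Assume that for some $a,b>0$ one has $$\left\|e^{a|\cdot|^2}f(\cdot,0)\right\|_{L^2(\mathbb R^m,d\gamma)}+\left\|e^{b|\cdot|^2}f(\cdot,s)\right\|_{L^2(\mathbb R^m,d\gamma)}<\infty.$$ If $a\,b\,\sin^2 s\ge\frac1{16}$, then $f\equiv0$ in $\mathbb R^m\times\mathbb R$.
   Context: Functions are complex-valued. $\mathscr L f=\Delta f-\langle x,\nabla f\rangle$ is the Ornstein-Uhlenbeck operator on $\mathbb R^m$ and $d\gamma(x)=(2\pi)^{-m/2}e^{-|x|^2/2}dx$ is its invariant measure. $\mathscr L$ is self-adjoint in $L^2(\mathbb R^m,d\gamma)$, and $e^{it\mathscr L}$, $t\in\mathbb R$, is the associated strongly continuous group of unitary operators on $L^2(\mathbb R^m,d\gamma)$ (Stone's theorem), so that $f(\cdot,0)=\varphi$. Elements of $L^2$ are functions up to a.e. equality. *)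

theory Defs
  imports "HOL-Analysis.Analysis"
begin

section \<open>The space $L^2(M)$ of complex-valued functions\<close>

text \<open>Elements of $L^2$ are represented by measurable functions; two functions with the same values
  almost everywhere represent the same element. The norm takes values in $[0,\infty]$.\<close>

definition l2_norm :: "'a measure \<Rightarrow> ('a \<Rightarrow> complex) \<Rightarrow> ennreal" where
  "l2_norm M f = (let I = (\<integral>\<^sup>+x. ennreal ((cmod (f x))\<^sup>2) \<partial>M)
     in if I = \<infinity> then \<infinity> else ennreal (sqrt (enn2real I)))"

definition l2_space :: "'a measure \<Rightarrow> ('a \<Rightarrow> complex) set" where
  "l2_space M = {f \<in> borel_measurable M. l2_norm M f < \<infinity>}"

definition l2_inner :: "'a measure \<Rightarrow> ('a \<Rightarrow> complex) \<Rightarrow> ('a \<Rightarrow> complex) \<Rightarrow> complex" where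
  "l2_inner M f g = (\<integral>x. f x * cnj (g x) \<partial>M)"

section \<open>One-parameter unitary groups and their generators\<close>

text \<open>Operators act on representatives, so identities between elements of $L^2$ are stated almost
  everywhere. Linearity and preservation of the inner product imply that a unitary operator
  respects equality almost everywhere.\<close>

definition l2_unitary ::
  "'a measure \<Rightarrow> (('a \<Rightarrow> complex) \<Rightarrow> ('a \<Rightarrow> complex)) \<Rightarrow> bool" where
  "l2_unitary M V \<longleftrightarrow>
     (\<forall>f \<in> l2_space M. V f \<in> l2_space M) \<and>
     (\<forall>f \<in> l2_space M. \<forall>g \<in> l2_space M. \<forall>c d. AE x in M.
        V (\<lambda>y. c * f y + d * g y) x = c * V f x + d * V g x) \<and>
     (\<forall>f \<in> l2_space M. \<forall>g \<in> l2_space M. l2_inner M (V f) (V g) = l2_inner M f g) \<and>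
     (\<forall>g \<in> l2_space M. \<exists>f \<in> l2_space M. AE x in M. V f x = g x)"

definition unitary_group ::
  "'a measure \<Rightarrow> (real \<Rightarrow> ('a \<Rightarrow> complex) \<Rightarrow> ('a \<Rightarrow> complex)) \<Rightarrow> bool" where
  "unitary_group M U \<longleftrightarrow>
     (\<forall>t. l2_unitary M (U t)) \<and>
     (\<forall>f \<in> l2_space M. AE x in M. U 0 f x = f x) \<and>
     (\<forall>f \<in> l2_space M. \<forall>t r. AE x in M. U (t + r) f x = U t (U r f) x) \<and>
     (\<forall>f \<in> l2_space M. \<forall>t. ((\<lambda>r. l2_norm M (\<lambda>x. U r f x - U t f x)) \<longlongrightarrow> 0) (at t))"

text \<open>Unbounded operators are given by their graphs.\<close>

definition generator ::
  "'a measure \<Rightarrow> (real \<Rightarrow> ('a \<Rightarrow> complex) \<Rightarrow> ('a \<Rightarrow> complex))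
     \<Rightarrow> (('a \<Rightarrow> complex) \<times> ('a \<Rightarrow> complex)) set" where
  "generator M U = {(f, g). f \<in> l2_space M \<and> g \<in> l2_space M \<and>
     ((\<lambda>h. l2_norm M (\<lambda>x. (U h f x - f x) / complex_of_real h - g x)) \<longlongrightarrow> 0) (at 0)}"

text \<open>\<open>U t\<close> is $e^{itA}$ in the sense of Stone's theorem: \<open>U\<close> is the strongly continuous unitary
  group whose generator, domain included, is $iA$. For self-adjoint $A$ such a \<open>U\<close> exists and is
  unique up to the choice of representatives.\<close>

definition is_exp_it ::
  "'a measure \<Rightarrow> (('a \<Rightarrow> complex) \<times> ('a \<Rightarrow> complex)) set
     \<Rightarrow> (real \<Rightarrow> ('a \<Rightarrow> complex) \<Rightarrow> ('a \<Rightarrow> complex)) \<Rightarrow> bool" where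
  "is_exp_it M A U \<longleftrightarrow>
     unitary_group M U \<and> generator M U = {(f, \<lambda>x. \<i> * g x) | f g. (f, g) \<in> A}"

section \<open>The Ornstein-Uhlenbeck operator\<close>

definition gauss_measure :: "(real ^ 'm::finite) measure" where
  "gauss_measure = density lborel
     (\<lambda>x. ennreal ((2 * pi) powr (- (real CARD('m) / 2)) * exp (- ((norm x)\<^sup>2 / 2))))"

definition partial ::
  "'m::finite \<Rightarrow> (real ^ 'm \<Rightarrow> complex) \<Rightarrow> real ^ 'm \<Rightarrow> complex" where
  "partial i f x = frechet_derivative f (at x) (axis i 1)"

primrec C_k :: "nat \<Rightarrow> (real ^ 'm::finite \<Rightarrow> complex) \<Rightarrow> bool" where
  "C_k 0 f \<longleftrightarrow> continuous_on UNIV f"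
| "C_k (Suc k) f \<longleftrightarrow> (\<forall>x. f differentiable (at x)) \<and> (\<forall>i. C_k k (partial i f))"

definition test_functions :: "(real ^ 'm::finite \<Rightarrow> complex) set" where
  "test_functions = {u. (\<forall>k. C_k k u) \<and> compact (closure {x. u x \<noteq> 0})}"

definition ou_diff :: "(real ^ 'm::finite \<Rightarrow> complex) \<Rightarrow> real ^ 'm \<Rightarrow> complex" where
  "ou_diff u x =
     (\<Sum>i\<in>UNIV. partial i (partial i u) x) - (\<Sum>i\<in>UNIV. complex_of_real (x $ i) * partial i u x)"

text \<open>The self-adjoint operator on $L^2(\gamma)$: the expression $\Delta - \langle x,\nabla\rangle$ is
  essentially self-adjoint on $C_c^\infty(\mathbb{R}^m)$, so its $L^2(\gamma)$-closure from there is
  its only self-adjoint realization.\<close>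

definition ou_operator ::
  "((real ^ 'm::finite \<Rightarrow> complex) \<times> (real ^ 'm \<Rightarrow> complex)) set" where
  "ou_operator = {(f, g). f \<in> l2_space gauss_measure \<and> g \<in> l2_space gauss_measure \<and>
     (\<exists>u. (\<forall>n::nat. u n \<in> test_functions) \<and>
        (\<lambda>n. l2_norm gauss_measure (\<lambda>x. u n x - f x)) \<longlonglongrightarrow> 0 \<and>
        (\<lambda>n. l2_norm gauss_measure (\<lambda>x. ou_diff (u n) x - g x)) \<longlonglongrightarrow> 0)}"

end

theory Submission
  imports Defs "HOL-Probability.Probability" "HOL-Complex_Analysis.Complex_Analysis"
    "HOL-Real_Asymp.Real_Asymp"
begin

text \<open>Fix a unit vector \<open>w\<close> and let $E_\lambda(x) = e^{\lambda\langle w,x\rangle-\lambda^2/2}$,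
  $\lambda\in\mathbb C$. Then $e^{it\mathscr L}E_\lambda = E_{e^{-it}\lambda}$, so the transform
  $F_t(\lambda) = \int f(\cdot,t)E_\lambda\,d\gamma$ satisfies $F_0(\lambda) = F_s(e^{is}\lambda)$: the
  evolution merely rotates this entire function. The two decay assumptions bound $F_0$ by
  $e^{\alpha(\mathrm{Re}\,\lambda)^2-\mathrm{Re}\,\lambda^2/2}$ with $\alpha = 1/(4a+1)$, and by the rotated analogue
  with $\beta = 1/(4b+1)$. Decreasing $a$ we may assume $ab\sin^2 s = 1/16$, that is
  $(1-\alpha)(1-\beta)\sin^2 s = \alpha\beta$. This is exactly the condition under which, after multiplication
  by $e^{-k\lambda^2/2}$ for a suitable $k$ and a rotation, the bounds become $e^{\alpha x^2}$ and $e^{\beta y^2}$ in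
  perpendicular directions. Phragmen-Lindelof and Liouville then force a constant, and the constant is $0$
  because the first bound can be improved to $o(1)$ along the imaginary axis. Hence all $F_0$ vanish, which
  includes the Fourier transform of $\varphi\,d\gamma$, and $\varphi = 0$.\<close>

text \<open>For unit \<open>w\<close>, \<open>gauss_exp w l\<close> is the generating function of
  the Hermite polynomials in \<open>w \<bullet> x\<close>, and the operator multiplies the one of
  degree n by -n. On this family it therefore acts as \<open>- l\<close> times the derivative in
  \<open>l\<close>, and its group rotates \<open>l\<close>. The rotation is proved on the side of
  the exponentials because \<phi> need not lie in the domain of the generator. The price is that the
  operator is a closure from compactly supported functions, so every exponential has to be reached
  by cutoffs. The constant \<open>\<alpha> = 1 / (4 * a + 1)\<close> comes from completing a square
  once the weight has been split off. It satisfies \<open>1 - \<alpha> = 4 * a * \<alpha>\<close>,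
  and this turns \<open>16 * a * b * (sin s)^2 = 1\<close> into the condition on \<alpha> and
  \<beta>. One direction \<open>w\<close> at a time is enough, since every frequency is a multiple
  of a unit vector; the complex analysis thus takes place in one variable.\<close>

unbundle no fps_syntax

section \<open>Entire functions bounded in perpendicular directions\<close>

text \<open>In the coordinate \<open>w\<close> with \<open>z = exp w\<close> the sector becomes a strip, and the damping factor
  $e^{-\varepsilon z^\rho}$, $2 < \rho < \pi/(q-p)$, needs no branch of $z^\rho$.\<close>

lemma phragmen_lindelof_sector:
  fixes f :: "complex \<Rightarrow> complex"
  assumes hol: "f holomorphic_on UNIV" and pq: "p < q" "q < p + pi / 2"
    and lo: "\<And>r. r \<ge> 1 \<Longrightarrow> cmod (f (of_real r * cis p)) \<le> C"
    and hi: "\<And>r. r \<ge> 1 \<Longrightarrow> cmod (f (of_real r * cis q)) \<le> C"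
    and unit: "\<And>t. p \<le> t \<Longrightarrow> t \<le> q \<Longrightarrow> cmod (f (cis t)) \<le> C"
    and growth: "\<And>z. cmod (f z) \<le> A * exp (K * (cmod z)\<^sup>2)"
    and C: "C > 0" and rt: "r \<ge> 1" "p \<le> t" "t \<le> q"
  shows "cmod (f (of_real r * cis t)) \<le> C"
proof -
  define d where "d = (q - p) / 2"
  define m where "m = (p + q) / 2"
  have d: "0 < d" "d < pi / 4" using pq by (auto simp: d_def)
  \<comment> \<open>The midpoint of the admissible window from 2 to \<open>pi / (2 * d)\<close>,
    which is nonempty because the opening \<open>2 * d\<close> is below
    \<open>pi / 2\<close>.\<close>
  define \<rho> where "\<rho> = 1 + pi / (4 * d)"
  have rho: "\<rho> > 2" "\<rho> * d < pi / 2" using d by (auto simp: \<rho>_def field_simps)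
  define c where "c = cos (\<rho> * d)"
  have c: "c > 0" unfolding c_def using rho d by (intro cos_gt_zero_pi) (auto intro: less_le_trans[of _ 0])
  have A: "A \<ge> 0" using growth[of 0] by (auto intro: order_trans[OF norm_ge_zero])
  define w where "w = Complex (ln r) t"
  have ew: "exp w = of_real r * cis t" using rt by (simp add: w_def exp_eq_polar)
  have bound: "cmod (f (exp w)) * exp (- e * Re (exp (of_real \<rho> * (w - \<i> * of_real m)))) \<le> C"
    if e: "e > 0" for e
  proof -
    define g where "g z = f (exp z) * exp (- of_real e * exp (of_real \<rho> * (z - \<i> * of_real m)))" for z
    have ng: "cmod (g z) = cmod (f (exp z)) * exp (- e * Re (exp (of_real \<rho> * (z - \<i> * of_real m))))" for z
      by (simp add: g_def norm_mult)
    \<comment> \<open>In the strip, the argument of the damping exponential stays within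
      \<open>\<rho> * d < pi / 2\<close> of 0, so its real part is at least the fixed fraction
      \<open>c\<close> of its modulus.\<close>
    have re: "Re (exp (of_real \<rho> * (z - \<i> * of_real m))) \<ge> exp (\<rho> * Re z) * c"
      if "p \<le> Im z" "Im z \<le> q" for z
    proof -
      have "\<bar>Im z - m\<bar> \<le> d" using that by (auto simp: m_def d_def abs_le_iff field_simps)
      then have "\<rho> * \<bar>Im z - m\<bar> \<le> \<rho> * d" using rho by (intro mult_left_mono) auto
      then have "cos \<bar>\<rho> * (Im z - m)\<bar> \<ge> c"
        unfolding c_def using rho d by (intro cos_monotone_0_pi_le) (auto simp: abs_mult)
      then show ?thesis by (simp add: Re_exp)
    qed
    \<comment> \<open>Since \<open>\<rho> > 2\<close>, the damping beats growth of order two; this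
      decides how far right the rectangle must reach for its last side to be harmless.\<close>
    have "filterlim (\<lambda>N. K * (exp N)\<^sup>2 - e * (exp (\<rho> * N) * c)) at_bot at_top"
    proof -
      define d1 where "d1 = e * c"
      define d2 where "d2 = \<rho> - 2"
      have "d1 > 0" "d2 > 0" using e c rho by (auto simp: d1_def d2_def)
      then have "filterlim (\<lambda>N. exp (2 * N) * (K - d1 * exp (d2 * N))) at_bot at_top"
        by real_asymp
      also have "(\<lambda>N. exp (2 * N) * (K - d1 * exp (d2 * N))) = (\<lambda>N. K * (exp N)\<^sup>2 - e * (exp (\<rho> * N) * c))"
        by (simp add: fun_eq_iff d1_def d2_def algebra_simps flip: exp_double exp_add)
      finally show ?thesis .
    qed
    then have "((\<lambda>N. A * exp (K * (exp N)\<^sup>2 - e * (exp (\<rho> * N) * c))) \<longlongrightarrow> A * 0) at_top"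
      by (intro tendsto_mult tendsto_const filterlim_compose[OF exp_at_bot])
    then have "eventually (\<lambda>N. A * exp (K * (exp N)\<^sup>2 - e * (exp (\<rho> * N) * c)) < C) at_top"
      using C by (intro order_tendstoD(2)) auto
    then have "eventually (\<lambda>N. A * exp (K * (exp N)\<^sup>2 - e * (exp (\<rho> * N) * c)) < C \<and> N > ln r) at_top"
      using eventually_gt_at_top by (rule eventually_conj)
    then obtain N where N: "A * exp (K * (exp N)\<^sup>2 - e * (exp (\<rho> * N) * c)) < C" "N > ln r"
      by (auto dest!: eventually_happens'[OF trivial_limit_at_top_linorder])
    have N0: "N > 0" using N(2) rt(1) ln_ge_zero[of r] by linarith
    define S where "S = cbox (Complex 0 p) (Complex N q)"
    have "cmod (g w) \<le> C"
    proof (rule maximum_modulus_frontier[where f = g and S = S and B = C and \<xi> = w])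
      have "g holomorphic_on UNIV"
        unfolding g_def by (intro holomorphic_intros holomorphic_on_compose_gen[OF _ hol, unfolded o_def]) auto
      then show "g holomorphic_on interior S" "continuous_on (closure S) g"
        by (auto intro: holomorphic_on_subset holomorphic_on_imp_continuous_on)
      show "bounded S" by (simp add: S_def)
      show "w \<in> S"
        using rt N by (auto simp: S_def w_def in_cbox_complex_iff)
      fix z assume "z \<in> frontier S"
      then have z: "0 \<le> Re z" "Re z \<le> N" "p \<le> Im z" "Im z \<le> q"
          and bd: "Re z = 0 \<or> Re z = N \<or> Im z = p \<or> Im z = q"
        by (force simp: S_def frontier_cbox in_cbox_complex_iff in_box_complex_iff)+
      have ez: "exp z = of_real (exp (Re z)) * cis (Im z)" by (simp add: exp_eq_polar)
      have "0 \<le> Re (exp (of_real \<rho> * (z - \<i> * of_real m)))"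
        by (rule order_trans[OF _ re]) (use z c in auto)
      then have le1: "cmod (g z) \<le> cmod (f (exp z))"
        unfolding ng using e by (intro mult_right_le_one_le) auto
      from bd show "cmod (g z) \<le> C"
      proof (elim disjE)
        assume "Re z = 0"
        then show ?thesis using le1 unit[OF z(3,4)] unfolding ez by simp
      next
        assume "Im z = p"
        then show ?thesis using le1 lo[of "exp (Re z)"] z unfolding ez by simp
      next
        assume "Im z = q"
        then show ?thesis using le1 hi[of "exp (Re z)"] z unfolding ez by simp
      next
        assume eN: "Re z = N"
        have "cmod (g z) \<le> A * exp (K * (cmod (exp z))\<^sup>2) * exp (- e * (exp (\<rho> * Re z) * c))"
          unfolding ng using re[OF z(3,4)] e A growth[of "exp z"] by (intro mult_mono) auto
        also have "\<dots> = A * exp (K * (exp N)\<^sup>2 - e * (exp (\<rho> * N) * c))"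
          by (simp add: eN exp_diff exp_minus field_simps)
        finally show ?thesis using N by simp
      qed
    qed
    then show ?thesis by (simp add: ng)
  qed
  \<comment> \<open>The bound holds for every \<open>e > 0\<close> at the fixed point
    \<open>w\<close>; letting \<open>e\<close> tend to 0 removes the damping.\<close>
  define X where "X = Re (exp (of_real \<rho> * (w - \<i> * of_real m)))"
  have "((\<lambda>e. cmod (f (exp w)) * exp (- e * X)) \<longlongrightarrow> cmod (f (exp w)) * exp (- 0 * X)) (at_right 0)"
    by (intro tendsto_intros)
  then have "cmod (f (exp w)) * exp (- 0 * X) \<le> C"
    by (rule tendsto_upperbound) (use bound in \<open>auto simp: X_def eventually_at_filter\<close>)
  then show ?thesis by (simp add: ew)
qed

text \<open>A quadrant has exactly the opening at which Phragmen-Lindelof fails for order two. So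
  the sectors from 0 to \<open>q < pi / 2\<close> are used. The bound in \<open>Im z\<close>
  controls the real axis; on the other ray the growth allowed by the bound in \<open>Re z\<close> is
  cancelled by \<open>exp (\<i> * of_real M * z\<^sup>2)\<close>, whose modulus
  \<open>exp (- 2 * M * Re z * Im z)\<close> is at most 1 in the quadrant. Then \<open>q\<close>
  tends to \<open>pi / 2\<close>.\<close>

lemma entire_bounded_quadrant:
  fixes P :: "complex \<Rightarrow> complex"
  assumes hol: "P holomorphic_on UNIV" and "C > 0" "\<alpha> \<ge> 0" "\<beta> \<ge> 0"
    and bx: "\<And>z. cmod (P z) \<le> C * exp (\<alpha> * (Re z)\<^sup>2)"
    and by_im: "\<And>z. cmod (P z) \<le> C * exp (\<beta> * (Im z)\<^sup>2)"
    and z: "Re z > 0" "Im z > 0"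
  shows "cmod (P z) \<le> C * exp \<alpha>"
proof -
  define t where "t = Arg z"
  have zt: "z = of_real (cmod z) * cis t" by (simp add: t_def rcis_cmod_Arg flip: rcis_def)
  have t: "0 < t" "t < pi / 2" unfolding t_def
    using z Arg_Re_pos[of z] Arg_lt_pi[of z] by auto
  \<comment> \<open>The factor \<open>exp \<alpha>\<close> in the conclusion arises here: the sector
    lemma starts at radius 1 and needs a bound on the unit arc.\<close>
  have unit: "cmod (P z) \<le> C * exp \<alpha>" if "cmod z \<le> 1" for z
  proof -
    have "\<bar>Re z\<bar> \<le> 1" using abs_Re_le_cmod[of z] that by linarith
    then have "\<alpha> * (Re z)\<^sup>2 \<le> \<alpha>" using assms(3) by (simp add: mult_left_le abs_square_le_1)
    then have "C * exp (\<alpha> * (Re z)\<^sup>2) \<le> C * exp \<alpha>" using \<open>C > 0\<close> by simp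
    then show ?thesis using bx[of z] by linarith
  qed
  have CC: "C \<le> C * exp \<alpha>" using \<open>C > 0\<close> assms(3) by simp
  have main: "cmod (P z) * exp (- \<alpha> * cot q * Re z * Im z) \<le> C * exp \<alpha>" if q: "t < q" "q < pi / 2" for q
  proof -
    \<comment> \<open>with this \<open>M\<close> the growth of \<open>P\<close> is cancelled exactly on the ray of argument \<open>q\<close>,
        and \<open>M\<close> tends to 0 as \<open>q\<close> tends to \<open>pi / 2\<close>\<close>
    define M where "M = \<alpha> / 2 * cot q"
    have cq: "cos q > 0" "sin q > 0" using q t by (auto intro!: cos_gt_zero_pi sin_gt_zero)
    have M: "M \<ge> 0" using cq assms(3) by (simp add: M_def cot_def)
    define f where "f z = P z * exp (\<i> * of_real M * z\<^sup>2)" for z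
    have nf: "cmod (f z) = cmod (P z) * exp (- 2 * M * Re z * Im z)" for z
      by (simp add: f_def norm_mult power2_eq_square algebra_simps)
    have nfle: "cmod (f z) \<le> cmod (P z)" if "Re z \<ge> 0" "Im z \<ge> 0" for z
      unfolding nf using that M by (intro mult_right_le_one_le) auto
    have "cmod (f z) \<le> C * exp \<alpha>"
    proof (cases "cmod z \<ge> 1")
      case False
      then show ?thesis using nfle[of z] unit[of z] z by simp
    next
      case True
      have "cmod (f (of_real (cmod z) * cis t)) \<le> C * exp \<alpha>"
      proof (rule phragmen_lindelof_sector[where p = 0 and q = q and A = C and K = "\<alpha> + M"])
        show "f holomorphic_on UNIV" unfolding f_def by (intro holomorphic_intros hol)
        show "cmod (f (of_real r * cis 0)) \<le> C * exp \<alpha>" if "r \<ge> 1" for r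
          using by_im[of "of_real r"] nfle[of "of_real r"] CC that by simp
        show "cmod (f (of_real r * cis q)) \<le> C * exp \<alpha>" if "r \<ge> 1" for r
        proof -
          have eq: "2 * M * (r * cos q) * (r * sin q) = \<alpha> * (r * cos q)\<^sup>2"
            using cq by (simp add: M_def cot_def power2_eq_square field_simps)
          have "cmod (f (of_real r * cis q)) \<le> C * exp (\<alpha> * (r * cos q)\<^sup>2) * exp (- (\<alpha> * (r * cos q)\<^sup>2))"
            unfolding nf using bx[of "of_real r * cis q"] eq by (auto intro!: mult_right_mono)
          also have "\<dots> = C" by (simp add: exp_minus)
          finally show ?thesis using CC by linarith
        qed
        show "cmod (f (cis x)) \<le> C * exp \<alpha>" if "0 \<le> x" "x \<le> q" for x
          using nfle[of "cis x"] unit[of "cis x"] that q cos_ge_zero[of x] sin_ge_zero[of x] by simp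
        show "cmod (f z) \<le> C * exp ((\<alpha> + M) * (cmod z)\<^sup>2)" for z
        proof -
          have "- 2 * Re z * Im z \<le> (cmod z)\<^sup>2"
            using zero_le_power2[of "Re z + Im z"] by (simp add: cmod_power2 power2_sum)
          then have "M * (- 2 * Re z * Im z) \<le> M * (cmod z)\<^sup>2" using M by (rule mult_left_mono)
          moreover have "\<alpha> * (Re z)\<^sup>2 \<le> \<alpha> * (cmod z)\<^sup>2"
            using assms(3) by (intro mult_left_mono) (auto simp: cmod_power2)
          ultimately have le: "\<alpha> * (Re z)\<^sup>2 + - 2 * M * Re z * Im z \<le> (\<alpha> + M) * (cmod z)\<^sup>2"
            by (simp add: algebra_simps)
          have "cmod (f z) \<le> C * exp (\<alpha> * (Re z)\<^sup>2) * exp (- 2 * M * Re z * Im z)"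
            unfolding nf by (intro mult_right_mono bx) auto
          also have "\<dots> = C * exp (\<alpha> * (Re z)\<^sup>2 + - 2 * M * Re z * Im z)" by (simp only: exp_add mult.assoc)
          also have "\<dots> \<le> C * exp ((\<alpha> + M) * (cmod z)\<^sup>2)" using le \<open>C > 0\<close> by simp
          finally show ?thesis .
        qed
      qed (use t q True \<open>C > 0\<close> in auto)
      then show ?thesis by (simp flip: zt)
    qed
    then show ?thesis by (simp add: nf M_def)
  qed
  \<comment> \<open>\<open>cot (pi / 2) = 0\<close>, so the correcting factor tends to 1 for fixed
    \<open>z\<close>.\<close>
  have "((\<lambda>q. cmod (P z) * exp (- \<alpha> * cot q * Re z * Im z)) \<longlongrightarrow> cmod (P z) * exp (- \<alpha> * cot (pi/2) * Re z * Im z)) (at_left (pi/2))"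
    by (intro tendsto_intros) auto
  then have "cmod (P z) * exp (- \<alpha> * cot (pi/2) * Re z * Im z) \<le> C * exp \<alpha>"
  proof (rule tendsto_upperbound)
    show "\<forall>\<^sub>F q in at_left (pi/2). cmod (P z) * exp (- \<alpha> * cot q * Re z * Im z) \<le> C * exp \<alpha>"
      using eventually_at_left_real[OF t(2)] by eventually_elim (rule main, simp_all)
  qed auto
  then show ?thesis by (simp add: cot_def)
qed


text \<open>Rotation by a quarter turn exchanges the real and imaginary parts up to sign, hence the
  roles of \<alpha> and \<beta>. The other quadrants thus reduce to the first, the axes are covered
  by the hypotheses, and Liouville applies.\<close>

lemma entire_bounded_cross_constant:
  fixes P :: "complex \<Rightarrow> complex"
  assumes hol: "P holomorphic_on UNIV" and C: "C > 0" and ab: "\<alpha> \<ge> 0" "\<beta> \<ge> 0"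
    and bx: "\<And>z. cmod (P z) \<le> C * exp (\<alpha> * (Re z)\<^sup>2)"
    and by_im: "\<And>z. cmod (P z) \<le> C * exp (\<beta> * (Im z)\<^sup>2)"
  shows "P z = P 0"
proof -
  define D where "D = C * exp (\<alpha> + \<beta>)"
  have D: "C * exp \<alpha> \<le> D" "C * exp \<beta> \<le> D" "C \<le> D"
    using C ab by (auto simp: D_def)
  have "cmod (P z) \<le> D" for z
  proof -
    consider "Re z = 0" | "Im z = 0" | "Re z > 0" "Im z > 0" | "Re z < 0" "Im z < 0"
      | "Re z > 0" "Im z < 0" | "Re z < 0" "Im z > 0" by linarith
    then show ?thesis
    proof cases
      case 1 then show ?thesis using bx[of z] D by simp
    next
      case 2 then show ?thesis using by_im[of z] D by simp
    next
      case 3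
      have "cmod (P z) \<le> C * exp \<alpha>"
        by (rule entire_bounded_quadrant[OF hol C ab bx by_im 3])
      then show ?thesis using D by simp
    next
      case 4
      have "cmod (P (- (- z))) \<le> C * exp \<alpha>"
        by (rule entire_bounded_quadrant[where P = "\<lambda>z. P (- z)" and \<beta> = \<beta>])
           (use C ab 4 bx[of "- z" for z] by_im[of "- z" for z] in
            \<open>auto intro!: holomorphic_intros holomorphic_on_compose_gen[OF _ hol, unfolded o_def]\<close>)
      then show ?thesis using D by simp
    next
      case 5
      have "cmod (P (- \<i> * (\<i> * z))) \<le> C * exp \<beta>"
        by (rule entire_bounded_quadrant[where P = "\<lambda>z. P (- \<i> * z)" and \<beta> = \<alpha>])
           (use C ab 5 bx[of "- \<i> * z" for z] by_im[of "- \<i> * z" for z] in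
            \<open>auto intro!: holomorphic_intros holomorphic_on_compose_gen[OF _ hol, unfolded o_def]\<close>)
      then show ?thesis using D by simp
    next
      case 6
      have "cmod (P (\<i> * (- \<i> * z))) \<le> C * exp \<beta>"
        by (rule entire_bounded_quadrant[where P = "\<lambda>z. P (\<i> * z)" and \<beta> = \<alpha>])
           (use C ab 6 bx[of "\<i> * z" for z] by_im[of "\<i> * z" for z] in
            \<open>auto intro!: holomorphic_intros holomorphic_on_compose_gen[OF _ hol, unfolded o_def]\<close>)
      then show ?thesis using D by simp
    qed
  qed
  then have "bounded (range P)" by (auto simp: bounded_iff)
  from Liouville_theorem[OF hol this] show ?thesis by (auto simp: constant_on_def)
qed

section \<open>Square-integrable functions\<close>

text \<open>The squared norm as a plain integral, without the case distinction and the root of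
  \<open>l2_norm\<close>; all estimates are made for it.\<close>

abbreviation sq_int :: "'a measure \<Rightarrow> ('a \<Rightarrow> complex) \<Rightarrow> ennreal" where
  "sq_int M f \<equiv> (\<integral>\<^sup>+x. ennreal ((cmod (f x))\<^sup>2) \<partial>M)"

lemma l2_norm_less_infinity_iff: "l2_norm M f < \<infinity> \<longleftrightarrow> sq_int M f < \<infinity>"
  by (cases "sq_int M f = \<infinity>") (simp_all add: l2_norm_def Let_def top.not_eq_extremum)

lemma l2_norm_power2: "(l2_norm M f)\<^sup>2 = sq_int M f"
proof (cases "sq_int M f = \<infinity>")
  case True
  then show ?thesis by (simp add: l2_norm_def power2_eq_square ennreal_mult_top)
next
  case False
  then have "ennreal (enn2real (sq_int M f)) = sq_int M f" by (simp add: less_top)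
  with False show ?thesis by (simp add: l2_norm_def Let_def ennreal_power)
qed

text \<open>Carries the limits in \<open>generator\<close> and \<open>ou_operator\<close> over to
  \<open>sq_int\<close>. In the backward direction a finite positive \<open>r\<close> below
  \<open>e\<close> is compared through squares.\<close>

lemma l2_norm_tendsto_0_iff:
  "((\<lambda>h. l2_norm M (f h)) \<longlongrightarrow> 0) F \<longleftrightarrow> ((\<lambda>h. sq_int M (f h)) \<longlongrightarrow> 0) F"
proof
  assume "((\<lambda>h. l2_norm M (f h)) \<longlongrightarrow> 0) F"
  then have "((\<lambda>h. l2_norm M (f h) * l2_norm M (f h)) \<longlongrightarrow> 0 * 0) F"
    by (intro tendsto_mult_ennreal) auto
  then show "((\<lambda>h. sq_int M (f h)) \<longlongrightarrow> 0) F" by (simp flip: l2_norm_power2 power2_eq_square)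
next
  assume lim: "((\<lambda>h. sq_int M (f h)) \<longlongrightarrow> 0) F"
  show "((\<lambda>h. l2_norm M (f h)) \<longlongrightarrow> 0) F"
  proof (rule order_tendstoI)
    fix e :: ennreal assume "0 < e"
    then obtain r where r: "0 < r" "ennreal r < e"
    proof -
      obtain y where y: "0 < y" "y < e" using dense[OF \<open>0 < e\<close>] by blast
      then obtain r where "0 \<le> r" "y = ennreal r" by (cases y) auto
      with y show ?thesis by (intro that[of r]) auto
    qed
    have "\<forall>\<^sub>F h in F. sq_int M (f h) < (ennreal r)\<^sup>2"
      using lim by (rule order_tendstoD(2)) (use r in \<open>simp add: ennreal_power\<close>)
    then show "\<forall>\<^sub>F h in F. l2_norm M (f h) < e"
    proof eventually_elim
      case (elim h)
      have "l2_norm M (f h) < ennreal r"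
      proof (rule ccontr)
        assume "\<not> l2_norm M (f h) < ennreal r"
        then have "(ennreal r)\<^sup>2 \<le> (l2_norm M (f h))\<^sup>2" by (intro power_mono) auto
        with elim show False by (simp add: l2_norm_power2 not_le[symmetric])
      qed
      then show ?case using r by simp
    qed
  qed simp
qed

lemma l2_space_iff: "f \<in> l2_space M \<longleftrightarrow> f \<in> borel_measurable M \<and> integrable M (\<lambda>x. (cmod (f x))\<^sup>2)"
  unfolding l2_space_def l2_norm_less_infinity_iff integrable_iff_bounded by auto

lemma l2_space_measurable: "f \<in> l2_space M \<Longrightarrow> f \<in> borel_measurable M"
  by (simp add: l2_space_iff)

lemma sq_int_eq: "f \<in> l2_space M \<Longrightarrow> sq_int M f = ennreal (\<integral>x. (cmod (f x))\<^sup>2 \<partial>M)"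
  by (intro nn_integral_eq_integral) (auto simp: l2_space_iff)

lemma l2_spaceI_bounded:
  assumes "g \<in> l2_space M" "f \<in> borel_measurable M" "\<And>x. cmod (f x) \<le> C * cmod (g x)"
  shows "f \<in> l2_space M"
proof -
  have "integrable M (\<lambda>x. C\<^sup>2 * (cmod (g x))\<^sup>2)" using assms by (simp add: l2_space_iff)
  then have "integrable M (\<lambda>x. (cmod (f x))\<^sup>2)"
    by (rule Bochner_Integration.integrable_bound)
       (use assms power_mono[OF assms(3) norm_ge_zero, of _ 2] in \<open>auto simp: power_mult_distrib\<close>)
  with assms show ?thesis by (simp add: l2_space_iff)
qed

lemma sq_norm_add_le: "(cmod (u + v))\<^sup>2 \<le> 2 * (cmod u)\<^sup>2 + 2 * (cmod v)\<^sup>2"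
proof -
  have "(cmod (u + v))\<^sup>2 \<le> (cmod u + cmod v)\<^sup>2" by (intro power_mono norm_triangle_ineq) auto
  also have "\<dots> \<le> 2 * (cmod u)\<^sup>2 + 2 * (cmod v)\<^sup>2"
    using zero_le_power2[of "cmod u - cmod v"] by (simp add: power2_sum power2_diff)
  finally show ?thesis .
qed

lemma l2_space_add:
  assumes "f \<in> l2_space M" "g \<in> l2_space M" shows "(\<lambda>x. f x + g x) \<in> l2_space M"
proof -
  have "integrable M (\<lambda>x. 2 * (cmod (f x))\<^sup>2 + 2 * (cmod (g x))\<^sup>2)" using assms by (simp add: l2_space_iff)
  then have "integrable M (\<lambda>x. (cmod (f x + g x))\<^sup>2)"
    by (rule Bochner_Integration.integrable_bound)
       (use assms sq_norm_add_le in \<open>auto simp: l2_space_iff\<close>)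
  with assms show ?thesis by (auto simp: l2_space_iff intro!: borel_measurable_add)
qed

lemma l2_space_mult_const: "f \<in> l2_space M \<Longrightarrow> (\<lambda>x. c * f x) \<in> l2_space M"
  by (rule l2_spaceI_bounded[where C = "cmod c" and g = f])
     (simp_all add: l2_space_measurable norm_mult borel_measurable_times)

lemma l2_space_diff:
  "f \<in> l2_space M \<Longrightarrow> g \<in> l2_space M \<Longrightarrow> (\<lambda>x. f x - g x) \<in> l2_space M"
  using l2_space_add[of f M "\<lambda>x. (-1) * g x"] l2_space_mult_const[of g M "-1"] by simp

lemma sq_int_add_le:
  assumes [measurable]: "f \<in> borel_measurable M" "g \<in> borel_measurable M"
  shows "sq_int M (\<lambda>x. f x + g x) \<le> 2 * sq_int M f + 2 * sq_int M g"
proof -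
  have "sq_int M (\<lambda>x. f x + g x) \<le> (\<integral>\<^sup>+x. 2 * ennreal ((cmod (f x))\<^sup>2) + 2 * ennreal ((cmod (g x))\<^sup>2) \<partial>M)"
  proof (rule nn_integral_mono)
    fix x
    have "ennreal ((cmod (f x + g x))\<^sup>2) \<le> ennreal (2 * (cmod (f x))\<^sup>2 + 2 * (cmod (g x))\<^sup>2)"
      by (intro ennreal_leI sq_norm_add_le)
    then show "ennreal ((cmod (f x + g x))\<^sup>2) \<le> 2 * ennreal ((cmod (f x))\<^sup>2) + 2 * ennreal ((cmod (g x))\<^sup>2)"
      by (simp add: ennreal_plus ennreal_mult)
  qed
  then show ?thesis by (simp add: nn_integral_add nn_integral_cmult)
qed

lemma l2_inner_integrable:
  assumes "f \<in> l2_space M" "g \<in> l2_space M"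
  shows "integrable M (\<lambda>x. f x * cnj (g x))"
proof -
  have [measurable]: "f \<in> borel_measurable M" "g \<in> borel_measurable M"
    using assms by (auto simp: l2_space_iff)
  have [measurable]: "(\<lambda>x. cnj (g x)) \<in> borel_measurable M"
    by (rule borel_measurable_continuous_on[OF continuous_on_cnj]) (auto intro!: continuous_intros)
  have "integrable M (\<lambda>x. (cmod (f x))\<^sup>2 + (cmod (g x))\<^sup>2)" using assms by (simp add: l2_space_iff)
  then show ?thesis
  proof (rule Bochner_Integration.integrable_bound)
    show "AE x in M. norm (f x * cnj (g x)) \<le> norm ((cmod (f x))\<^sup>2 + (cmod (g x))\<^sup>2)"
    proof (rule AE_I2)
      fix x
      have "2 * (cmod (f x) * cmod (g x)) \<le> (cmod (f x))\<^sup>2 + (cmod (g x))\<^sup>2"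
        using zero_le_power2[of "cmod (f x) - cmod (g x)"] by (simp add: power2_diff)
      moreover have "0 \<le> cmod (f x) * cmod (g x)" by simp
      ultimately have "cmod (f x) * cmod (g x) \<le> (cmod (f x))\<^sup>2 + (cmod (g x))\<^sup>2" by linarith
      then show "norm (f x * cnj (g x)) \<le> norm ((cmod (f x))\<^sup>2 + (cmod (g x))\<^sup>2)"
        by (simp add: norm_mult)
    qed
  qed auto
qed

lemma l2_inner_cauchy_schwarz:
  assumes "f \<in> l2_space M" "g \<in> l2_space M"
  shows "ennreal ((cmod (l2_inner M f g))\<^sup>2) \<le> sq_int M f * sq_int M g"
proof -
  have [measurable]: "f \<in> borel_measurable M" "g \<in> borel_measurable M"
    using assms by (auto simp: l2_space_iff)
  have "ennreal (cmod (l2_inner M f g)) \<le> (\<integral>\<^sup>+x. ennreal (cmod (f x)) * ennreal (cmod (g x)) \<partial>M)"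
    unfolding l2_inner_def using integral_norm_bound_ennreal[OF l2_inner_integrable[OF assms]]
    by (simp add: norm_mult ennreal_mult)
  then have "(ennreal (cmod (l2_inner M f g)))\<^sup>2 \<le> (\<integral>\<^sup>+x. ennreal (cmod (f x)) * ennreal (cmod (g x)) \<partial>M)\<^sup>2"
    by (intro power_mono) auto
  also have "\<dots> \<le> (\<integral>\<^sup>+x. (ennreal (cmod (f x)))\<^sup>2 \<partial>M) * (\<integral>\<^sup>+x. (ennreal (cmod (g x)))\<^sup>2 \<partial>M)"
    by (intro Cauchy_Schwarz_nn_integral) auto
  finally show ?thesis by (simp add: ennreal_power)
qed

lemma sq_int_dominated_convergence:
  fixes u :: "nat \<Rightarrow> 'a \<Rightarrow> complex"
  assumes [measurable]: "\<And>n. u n \<in> borel_measurable M" "v \<in> borel_measurable M" "G \<in> borel_measurable M"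
    and G: "integrable M (\<lambda>x. (G x)\<^sup>2)"
    and dom: "\<And>n. AE x in M. cmod (u n x) \<le> G x" "AE x in M. cmod (v x) \<le> G x"
    and lim: "AE x in M. (\<lambda>n. u n x) \<longlonglongrightarrow> v x"
  shows "(\<lambda>n. sq_int M (\<lambda>x. u n x - v x)) \<longlonglongrightarrow> 0"
proof -
  have "(\<lambda>n. sq_int M (\<lambda>x. u n x - v x)) \<longlonglongrightarrow> (\<integral>\<^sup>+x. ennreal 0 \<partial>M)"
  proof (rule nn_integral_dominated_convergence[where w = "\<lambda>x. ennreal (4 * (G x)\<^sup>2)"])
    show "AE x in M. ennreal ((cmod (u n x - v x))\<^sup>2) \<le> ennreal (4 * (G x)\<^sup>2)" for n
      using dom(1)[of n] dom(2)
    proof eventually_elim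
      case (elim x)
      have "cmod (u n x - v x) \<le> 2 * G x" using elim norm_triangle_ineq4[of "u n x" "v x"] by linarith
      then have "(cmod (u n x - v x))\<^sup>2 \<le> (2 * G x)\<^sup>2" by (intro power_mono) auto
      then show ?case by (intro ennreal_leI) (simp add: power_mult_distrib)
    qed
    have "integrable M (\<lambda>x. 4 * (G x)\<^sup>2)" using G by simp
    then show "(\<integral>\<^sup>+ x. ennreal (4 * (G x)\<^sup>2) \<partial>M) < \<infinity>" unfolding integrable_iff_bounded by simp
    show "AE x in M. (\<lambda>n. ennreal ((cmod (u n x - v x))\<^sup>2)) \<longlonglongrightarrow> ennreal 0"
      using lim
    proof eventually_elim
      case (elim x)
      have "(\<lambda>n. (cmod (u n x - v x))\<^sup>2) \<longlonglongrightarrow> (cmod (v x - v x))\<^sup>2" by (intro tendsto_intros elim)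
      then show ?case by (intro tendsto_ennrealI) simp
    qed
  qed auto
  then show ?thesis by simp
qed

section \<open>The Gaussian measure\<close>

lemma sum_Basis_power2: "(\<Sum>b\<in>Basis. (x \<bullet> b)\<^sup>2) = (norm x)\<^sup>2"
proof -
  have "(norm x)\<^sup>2 = (\<Sum>b\<in>Basis. (x \<bullet> b) * (x \<bullet> b))"
    unfolding power2_norm_eq_inner by (rule euclidean_inner)
  then show ?thesis by (simp only: power2_eq_square)
qed

text \<open>The integrand factors over the coordinates, and each factor is a multiple of the normal
  density of variance \<open>1 / (2 * p)\<close>.\<close>

lemma integrable_exp_neg_norm_sq:
  assumes "p > 0"
  shows "integrable lborel (\<lambda>x::'a::euclidean_space. exp (- p * (norm x)\<^sup>2))"
proof (rule integrableI_nonneg)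
  have "integrable lborel (\<lambda>x. sqrt (pi / p) * normal_density 0 (1 / sqrt (2 * p)) x)"
    using assms by (intro integrable_mult_right integrable_normal_density) auto
  also have "(\<lambda>x. sqrt (pi / p) * normal_density 0 (1 / sqrt (2 * p)) x) = (\<lambda>x::real. exp (- p * x\<^sup>2))"
    using assms by (simp add: fun_eq_iff normal_density_def power_divide real_sqrt_divide field_simps)
  finally have 1: "nn_integral lborel (\<lambda>x::real. ennreal (exp (- p * x\<^sup>2))) < \<infinity>"
    unfolding integrable_iff_bounded by simp
  have "nn_integral lborel (\<lambda>x::'a. ennreal (exp (- p * (norm x)\<^sup>2))) =
      nn_integral lborel (\<lambda>x::'a. (\<Prod>b\<in>Basis. ennreal (exp (- p * (x \<bullet> b)\<^sup>2))))"
    by (simp add: prod_ennreal exp_sum[symmetric] sum_distrib_left[symmetric] sum_negf sum_Basis_power2)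
  also have "\<dots> = (\<Prod>b\<in>(Basis :: 'a set). (\<integral>\<^sup>+x. ennreal (exp (- p * x\<^sup>2)) \<partial>lborel))"
    by (rule nn_integral_lborel_prod) auto
  also have "\<dots> < \<infinity>" using 1 by (simp add: power_less_top_ennreal)
  finally show "nn_integral lborel (\<lambda>x::'a. ennreal (exp (- p * (norm x)\<^sup>2))) < \<infinity>" .
qed auto

definition gauss_density :: "real ^ 'm::finite \<Rightarrow> real" where
  "gauss_density x = (2 * pi) powr (- (real CARD('m) / 2)) * exp (- ((norm x)\<^sup>2 / 2))"

lemma gauss_density_pos: "gauss_density x > 0"
  by (simp add: gauss_density_def)

lemma gauss_density_measurable [measurable]: "gauss_density \<in> borel_measurable borel"
  unfolding gauss_density_def by measurable

lemma gauss_measure_eq: "gauss_measure = density lborel (\<lambda>x. ennreal (gauss_density x))"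
  by (simp add: gauss_measure_def gauss_density_def)

lemma sets_gauss_measure [simp, measurable_cong]: "sets gauss_measure = sets borel"
  and space_gauss_measure [simp]: "space gauss_measure = UNIV"
  by (simp_all add: gauss_measure_eq)

lemma AE_gauss_measure: "(AE x in gauss_measure. P x) \<longleftrightarrow> (AE x in lborel. P x)"
  unfolding gauss_measure_eq by (subst AE_density) (auto simp: gauss_density_pos)

lemma integrable_gauss_iff:
  fixes f :: "real ^ 'm::finite \<Rightarrow> 'b::{banach, second_countable_topology}"
  assumes "f \<in> borel_measurable borel"
  shows "integrable gauss_measure f \<longleftrightarrow> integrable lborel (\<lambda>x. gauss_density x *\<^sub>R f x)"
  unfolding gauss_measure_eq using assms
  by (intro integrable_density) (auto simp: less_imp_le gauss_density_pos)

lemma integral_gauss: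
  fixes f :: "real ^ 'm::finite \<Rightarrow> 'b::{banach, second_countable_topology}"
  assumes "f \<in> borel_measurable borel"
  shows "integral\<^sup>L gauss_measure f = integral\<^sup>L lborel (\<lambda>x. gauss_density x *\<^sub>R f x)"
  unfolding gauss_measure_eq using assms
  by (intro integral_density) (auto simp: less_imp_le gauss_density_pos)

text \<open>The dominating functions for the exponentials and their derivatives all have this
  growth. It follows from \<open>c * norm x \<le> c\<^sup>2 + (norm x)\<^sup>2 / 4\<close>, which
  leaves half of the Gaussian exponent.\<close>

lemma integrable_gauss_exp_norm: "integrable gauss_measure (\<lambda>x::real ^ 'm::finite. exp (c * norm x))"
proof -
  define K where "K = (2 * pi) powr (- (real CARD('m) / 2))"
  have "integrable lborel (\<lambda>x::real ^ 'm. K * exp (c\<^sup>2) * exp (- (1/4) * (norm x)\<^sup>2))"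
    by (intro integrable_mult_right integrable_exp_neg_norm_sq) auto
  then have "integrable lborel (\<lambda>x::real ^ 'm. gauss_density x *\<^sub>R exp (c * norm x))"
  proof (rule Bochner_Integration.integrable_bound)
    show "AE x::real ^ 'm in lborel. norm (gauss_density x *\<^sub>R exp (c * norm x))
        \<le> norm (K * exp (c\<^sup>2) * exp (- (1/4) * (norm x)\<^sup>2))"
    proof (rule AE_I2)
      fix x :: "real ^ 'm"
      have "- ((norm x)\<^sup>2 / 2) + c * norm x \<le> c\<^sup>2 + - (1/4) * (norm x)\<^sup>2"
        using zero_le_power2[of "c - norm x / 2"] by (simp add: power2_diff power_divide)
      then have "exp (- ((norm x)\<^sup>2 / 2)) * exp (c * norm x) \<le> exp (c\<^sup>2) * exp (- (1/4) * (norm x)\<^sup>2)"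
        unfolding exp_add[symmetric] by simp
      then have "K * (exp (- ((norm x)\<^sup>2 / 2)) * exp (c * norm x)) \<le> K * (exp (c\<^sup>2) * exp (- (1/4) * (norm x)\<^sup>2))"
        by (intro mult_left_mono) (auto simp: K_def)
      then show "norm (gauss_density x *\<^sub>R exp (c * norm x)) \<le> norm (K * exp (c\<^sup>2) * exp (- (1/4) * (norm x)\<^sup>2))"
        by (simp add: gauss_density_def abs_mult K_def mult.assoc)
    qed
  qed measurable
  then show ?thesis by (subst integrable_gauss_iff) auto
qed

lemma integrable_gauss_exp_norm_sq:
  "integrable gauss_measure (\<lambda>x::real ^ 'm::finite. (C * exp (c * norm x))\<^sup>2)"
  using integrable_gauss_exp_norm[of "2 * c", where 'm = 'm]
  by (simp add: power_mult_distrib exp_double[symmetric] mult.assoc)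

lemma l2_space_gauss_exp_bound:
  assumes "f \<in> borel_measurable borel" "\<And>x. cmod (f x) \<le> C * exp (c * norm x)"
  shows "f \<in> l2_space (gauss_measure :: (real ^ 'm::finite) measure)"
proof (rule l2_spaceI_bounded)
  show "(\<lambda>x. complex_of_real (exp (c * norm x))) \<in> l2_space (gauss_measure :: (real ^ 'm) measure)"
    using integrable_gauss_exp_norm[of "2 * c", where 'm = 'm] by (simp add: l2_space_iff exp_double[symmetric] mult.assoc)
qed (use assms in \<open>auto\<close>)

text \<open>Density and character both factor over the coordinates, which reduces this to the
  standard normal law. It later gives the total mass and presents Gaussian kernels as averages of
  characters.\<close>

lemma char_gauss_measure:
  fixes \<eta> :: "real ^ 'm::finite"
  shows "(\<integral>x. exp (\<i> * of_real (\<eta> \<bullet> x)) \<partial>gauss_measure) = of_real (exp (- ((norm \<eta>)\<^sup>2 / 2)))"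
proof -
  define g :: "real ^ 'm \<Rightarrow> real \<Rightarrow> complex" where
    "g b t = std_normal_density t *\<^sub>R iexp ((\<eta> \<bullet> b) * t)" for b t
  interpret product_sigma_finite "\<lambda>_::real ^ 'm. lborel :: real measure" by standard
  have g_int: "integrable lborel (g b)" for b
  proof (rule Bochner_Integration.integrable_bound[of _ std_normal_density])
    show "integrable lborel std_normal_density" by (rule integrable_normal_density) simp
    show "g b \<in> borel_measurable lborel" unfolding g_def by measurable
  qed (auto simp: g_def)
  have g1: "(\<integral>t. g b t \<partial>lborel) = of_real (exp (- (\<eta> \<bullet> b)\<^sup>2 / 2))" for b
    using fun_cong[OF char_std_normal_distribution, of "\<eta> \<bullet> b"]
    by (simp add: char_def g_def integral_density)
  have prod: "gauss_density x *\<^sub>R exp (\<i> * of_real (\<eta> \<bullet> x)) = (\<Prod>b\<in>Basis. g b (x \<bullet> b))" for x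
  proof -
    have "(\<Prod>b\<in>(Basis::(real^'m) set). std_normal_density (x \<bullet> b)) = gauss_density x"
    proof -
      have "(1 / sqrt (2 * pi)) ^ CARD('m) = (2 * pi) powr (- (real CARD('m) / 2))"
        by (simp add: powr_minus powr_half_sqrt[symmetric] powr_powr power_divide field_simps flip: powr_realpow)
      moreover have "(\<Prod>b\<in>Basis. exp (- (x \<bullet> b)\<^sup>2 / 2)) = exp (- ((norm x)\<^sup>2 / 2))"
        by (simp add: exp_sum[symmetric] sum_negf sum_divide_distrib[symmetric] sum_Basis_power2)
      ultimately show ?thesis
        unfolding std_normal_density_def prod.distrib gauss_density_def by simp
    qed
    moreover have "(\<Prod>b\<in>Basis. iexp ((\<eta> \<bullet> b) * (x \<bullet> b))) = exp (\<i> * of_real (\<eta> \<bullet> x))"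
      by (simp add: exp_sum[symmetric] sum_distrib_left[symmetric] euclidean_inner[of \<eta> x])
    ultimately show ?thesis
      by (simp add: g_def scaleR_conv_of_real prod.distrib flip: of_real_prod)
  qed
  have "(\<integral>x. exp (\<i> * of_real (\<eta> \<bullet> x)) \<partial>gauss_measure) = (\<integral>x. (\<Prod>b\<in>Basis. g b (x \<bullet> b)) \<partial>lborel)"
    by (subst integral_gauss) (auto simp: prod)
  also have "\<dots> = (\<integral>f. (\<Prod>b\<in>Basis. g b (f b)) \<partial>(\<Pi>\<^sub>M b\<in>Basis. lborel))"
  proof (subst lborel_eq, subst integral_distr)
    show "(\<lambda>x. \<Prod>b\<in>Basis. g b (x \<bullet> b)) \<in> borel_measurable borel" unfolding g_def by measurable
  qed (auto simp: inner_sum_left inner_Basis if_distrib sum.If_cases cong: if_cong intro!: Bochner_Integration.integral_cong prod.cong)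
  also have "\<dots> = (\<Prod>b\<in>Basis. of_real (exp (- (\<eta> \<bullet> b)\<^sup>2 / 2)))"
    by (subst product_integral_prod) (auto simp: g_int g1)
  also have "\<dots> = of_real (exp (- ((norm \<eta>)\<^sup>2 / 2)))"
    by (simp add: exp_sum[symmetric] sum_negf sum_divide_distrib[symmetric] sum_Basis_power2 flip: of_real_prod)
  finally show ?thesis .
qed

section \<open>Exponentials in the domain of the Ornstein-Uhlenbeck operator\<close>

definition flat_exp :: "nat \<Rightarrow> real \<Rightarrow> real" where
  "flat_exp k t = (if t > 0 then exp (- (1 / t)) / t ^ k else 0)"

lemma flat_exp_nonneg: "0 \<le> flat_exp k t"
  by (simp add: flat_exp_def)

text \<open>\<open>(1 / t) ^ k / fact k\<close> is a single term of the exponential series of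
  \<open>exp (1 / t)\<close>.\<close>

lemma flat_exp_le: "flat_exp k t \<le> fact k"
proof (cases "t > 0")
  case True
  have "(1 / t) ^ k / fact k \<le> exp (1 / t)"
    using sum_le_suminf[OF summable_exp_generic[of "1 / t"], of "{k}"] True
    by (simp add: exp_def divide_inverse_commute)
  then show ?thesis using True by (simp add: flat_exp_def exp_minus field_simps)
qed (simp add: flat_exp_def)

text \<open>The powers of \<open>1 / t\<close> are built into the family so that it is closed under
  differentiation; smoothness at 0 then needs only the first derivative of each member.\<close>

lemma flat_exp_has_derivative:
  "(flat_exp k has_real_derivative (flat_exp (k + 2) t - real k * flat_exp (k + 1) t)) (at t)"
proof -
  consider "t > 0" | "t < 0" | "t = 0" by linarith
  then show ?thesis
  proof cases
    case 1
    have "((\<lambda>t. exp (- (1 / t)) / t ^ k) has_real_derivative (flat_exp (k + 2) t - real k * flat_exp (k + 1) t)) (at t)"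
    proof -
      have "real k * t ^ (k - 1) = real k * t ^ k / t" using 1 by (cases k) auto
      then show ?thesis using 1
        by (auto intro!: derivative_eq_intros simp: flat_exp_def field_simps power2_eq_square)
    qed
    then show ?thesis
      by (rule has_field_derivative_transform_within_open[where S = "{0<..}"]) (use 1 in \<open>auto simp: flat_exp_def\<close>)
  next
    case 2
    have "((\<lambda>t. 0) has_real_derivative 0) (at t)" by simp
    then have "(flat_exp k has_real_derivative 0) (at t)"
      by (rule has_field_derivative_transform_within_open[where S = "{..<0}"]) (use 2 in \<open>auto simp: flat_exp_def\<close>)
    then show ?thesis using 2 by (simp add: flat_exp_def)
  next
    case 3
    \<comment> \<open>For positive \<open>h\<close> the quotient is
      \<open>flat_exp (k + 2) h * h\<close>, whose first factor is at most
      \<open>fact (k + 2)\<close>.\<close>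
    have le: "\<bar>flat_exp k h / h\<bar> \<le> fact (k + 2) * \<bar>h\<bar>" for h
    proof (cases "h > 0")
      case True
      then have "flat_exp k h / h = flat_exp (k + 2) h * h" by (simp add: flat_exp_def field_simps power2_eq_square)
      then show ?thesis using True flat_exp_le[of "k + 2" h] flat_exp_nonneg[of "k + 2" h] by (simp add: abs_mult mult_right_mono)
    next
      case False
      have "0 \<le> fact (k + 2) * \<bar>h\<bar>" by (intro mult_nonneg_nonneg) auto
      with False show ?thesis by (simp only: flat_exp_def if_False div_0 abs_zero)
    qed
    have "((\<lambda>h. flat_exp k h / h) \<longlongrightarrow> 0) (at 0)"
    proof (rule Lim_null_comparison)
      show "\<forall>\<^sub>F h in at 0. norm (flat_exp k h / h) \<le> fact (k + 2) * \<bar>h\<bar>" using le by simp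
      show "((\<lambda>h. fact (k + 2) * \<bar>h\<bar>) \<longlongrightarrow> (0::real)) (at 0)" by (auto intro!: tendsto_eq_intros)
    qed
    then show ?thesis using 3 by (simp add: DERIV_def flat_exp_def)
  qed
qed

text \<open>The total derivative with its coefficients made explicit: differentiability and all
  partial derivatives pass through sums and products by one rule each, and \<open>partial\<close> is
  read off at the end.\<close>

definition has_partials ::
  "(real ^ 'm::finite \<Rightarrow> complex) \<Rightarrow> ('m \<Rightarrow> real ^ 'm \<Rightarrow> complex) \<Rightarrow> bool" where
  "has_partials f f' \<longleftrightarrow>
     (\<forall>x. (f has_derivative (\<lambda>h. \<Sum>i\<in>UNIV. of_real (h $ i) * f' i x)) (at x))"

lemma has_partials_imp_partial:
  assumes "has_partials f f'" shows "partial i f = f' i"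
proof
  fix x
  have "frechet_derivative f (at x) = (\<lambda>h. \<Sum>i\<in>UNIV. of_real (h $ i) * f' i x)"
    using assms by (intro frechet_derivative_at[symmetric]) (simp add: has_partials_def)
  then show "partial i f x = f' i x"
    by (simp add: partial_def axis_def if_distrib[of complex_of_real] if_distrib[of "\<lambda>c. c * _"] cong: if_cong)
qed

lemma has_partials_differentiable: "has_partials f f' \<Longrightarrow> f differentiable (at x)"
  by (auto simp: has_partials_def differentiable_def)

lemma has_partials_const: "has_partials (\<lambda>x. c) (\<lambda>i x. 0)"
  by (simp add: has_partials_def)

lemma has_partials_add:
  "has_partials f f' \<Longrightarrow> has_partials g g' \<Longrightarrow> has_partials (\<lambda>x. f x + g x) (\<lambda>i x. f' i x + g' i x)"
  by (auto simp: has_partials_def distrib_left sum.distrib intro!: has_derivative_add)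

lemma has_partials_mult:
  assumes "has_partials f f'" "has_partials g g'"
  shows "has_partials (\<lambda>x. f x * g x) (\<lambda>i x. f' i x * g x + f x * g' i x)"
  unfolding has_partials_def
proof
  fix x
  have "((\<lambda>x. f x * g x) has_derivative
      (\<lambda>h. f x * (\<Sum>i\<in>UNIV. of_real (h $ i) * g' i x) + (\<Sum>i\<in>UNIV. of_real (h $ i) * f' i x) * g x)) (at x)"
    using assms by (intro has_derivative_mult) (auto simp: has_partials_def)
  then show "((\<lambda>x. f x * g x) has_derivative
      (\<lambda>h. \<Sum>i\<in>UNIV. of_real (h $ i) * (f' i x * g x + f x * g' i x))) (at x)"
    by (simp add: sum_distrib_left sum_distrib_right sum.distrib algebra_simps)
qed

lemma has_partials_coord:
  "has_partials (\<lambda>x. complex_of_real (x $ j)) (\<lambda>i x. if i = j then 1 else 0)"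
  unfolding has_partials_def
proof
  fix x
  have "((\<lambda>x. complex_of_real (x $ j)) has_derivative (\<lambda>h. of_real (h $ j))) (at x)"
    by (intro bounded_linear_imp_has_derivative bounded_linear_compose[OF bounded_linear_of_real bounded_linear_vec_nth])
  then show "((\<lambda>x. complex_of_real (x $ j)) has_derivative
      (\<lambda>h. \<Sum>i\<in>UNIV. of_real (h $ i) * (if i = j then 1 else 0))) (at x)"
    by (simp add: if_distrib sum.delta' cong: if_cong)
qed

lemma of_real_inner_vec:
  "(of_real (v \<bullet> h) :: complex) = (\<Sum>i\<in>UNIV. of_real (h $ i) * of_real (v $ i))"
  for v h :: "real ^ 'm::finite"
  by (simp add: inner_vec_def mult.commute)

definition gauss_exp :: "real ^ 'm::finite \<Rightarrow> complex \<Rightarrow> real ^ 'm \<Rightarrow> complex" where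
  "gauss_exp w l x = exp (l * of_real (w \<bullet> x) - l\<^sup>2 / 2)"

lemma has_partials_gauss_exp:
  "has_partials (gauss_exp w l) (\<lambda>i x. l * of_real (w $ i) * gauss_exp w l x)"
  unfolding has_partials_def
proof
  fix x
  have "((\<lambda>x. exp (l * of_real (w \<bullet> x) - l\<^sup>2 / 2)) has_derivative
      (\<lambda>h. exp (l * of_real (w \<bullet> x) - l\<^sup>2 / 2) * (l * of_real (w \<bullet> h)))) (at x)"
  proof -
    have "((\<lambda>x. l * of_real (w \<bullet> x) - l\<^sup>2 / 2) has_derivative (\<lambda>h. l * of_real (w \<bullet> h))) (at x)"
      by (auto intro!: derivative_eq_intros has_derivative_of_real)
    from has_derivative_compose[OF this DERIV_exp[unfolded has_field_derivative_def]] show ?thesis .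
  qed
  then show "(gauss_exp w l has_derivative
      (\<lambda>h. \<Sum>i\<in>UNIV. of_real (h $ i) * (l * of_real (w $ i) * gauss_exp w l x))) (at x)"
    unfolding gauss_exp_def[abs_def] of_real_inner_vec[of w h for h] sum_distrib_left
    by (simp only: mult_ac)
qed

text \<open>For \<open>r > 0\<close> a radial smooth function vanishing outside the ball of radius
  \<open>1 / sqrt r\<close>; the index \<open>k\<close> is there for its derivatives.\<close>

definition bump :: "nat \<Rightarrow> real \<Rightarrow> real ^ 'm::finite \<Rightarrow> complex" where
  "bump k r x = of_real (flat_exp k (1 - r * (x \<bullet> x)))"

text \<open>The chain rule, with the difference written as a sum with factor
  \<open>- of_nat k\<close> so that the right-hand side is visibly built by the rules of
  \<open>smooth_fns\<close>.\<close>

lemma has_partials_bump: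
  "has_partials (bump k r :: real ^ 'm::finite \<Rightarrow> complex)
     (\<lambda>i x. of_real (- 2 * r) * (of_real (x $ i) * (bump (k + 2) r x + (- of_nat k) * bump (k + 1) r x)))"
  unfolding has_partials_def
proof
  fix x :: "real ^ 'm"
  let ?d = "flat_exp (k + 2) (1 - r * (x \<bullet> x)) - real k * flat_exp (k + 1) (1 - r * (x \<bullet> x))"
  have "((\<lambda>x. 1 - r * (x \<bullet> x)) has_derivative (\<lambda>h. - 2 * r * (x \<bullet> h))) (at x)"
    by (auto intro!: derivative_eq_intros simp: inner_commute)
  from has_derivative_compose[OF this flat_exp_has_derivative[of k, unfolded has_field_derivative_def]]
  have "((\<lambda>x. flat_exp k (1 - r * (x \<bullet> x))) has_derivative (\<lambda>h. (- 2 * r * (x \<bullet> h)) * ?d)) (at x)"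
    by (simp only: mult.commute[of ?d])
  then have "((\<lambda>x. complex_of_real (flat_exp k (1 - r * (x \<bullet> x)))) has_derivative
     (\<lambda>h. of_real ((- 2 * r * (x \<bullet> h)) * (flat_exp (k + 2) (1 - r * (x \<bullet> x)) - real k * flat_exp (k + 1) (1 - r * (x \<bullet> x)))))) (at x)"
    by (rule has_derivative_of_real)
  then have "(bump k r has_derivative
      (\<lambda>h. of_real ((- 2 * r * (x \<bullet> h)) * (flat_exp (k + 2) (1 - r * (x \<bullet> x)) - real k * flat_exp (k + 1) (1 - r * (x \<bullet> x)))))) (at x)"
    by (simp only: bump_def[abs_def])
  then show "(bump k r has_derivative
      (\<lambda>h. \<Sum>i\<in>UNIV. of_real (h $ i) * (of_real (- 2 * r) * (of_real (x $ i) *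
        (bump (k + 2) r x + (- of_nat k) * bump (k + 1) r x))))) (at x)"
  proof (rule has_derivative_eq_rhs)
    let ?D = "complex_of_real (flat_exp (k + 2) (1 - r * (x \<bullet> x)) - real k * flat_exp (k + 1) (1 - r * (x \<bullet> x)))"
    show "(\<lambda>h. complex_of_real ((- 2 * r * (x \<bullet> h)) * (flat_exp (k + 2) (1 - r * (x \<bullet> x)) - real k * flat_exp (k + 1) (1 - r * (x \<bullet> x))))) =
      (\<lambda>h. \<Sum>i\<in>UNIV. of_real (h $ i) * (of_real (- 2 * r) * (of_real (x $ i) *
        (bump (k + 2) r x + (- of_nat k) * bump (k + 1) r x))))"
    proof
      fix h
      have D: "bump (k + 2) r x + (- of_nat k) * bump (k + 1) r x = ?D" by (simp add: bump_def)
      have "complex_of_real ((- 2 * r * (x \<bullet> h)) * (flat_exp (k + 2) (1 - r * (x \<bullet> x)) - real k * flat_exp (k + 1) (1 - r * (x \<bullet> x))))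
        = of_real (- 2 * r) * of_real (x \<bullet> h) * ?D" by (simp only: of_real_mult)
      then show "complex_of_real ((- 2 * r * (x \<bullet> h)) * (flat_exp (k + 2) (1 - r * (x \<bullet> x)) - real k * flat_exp (k + 1) (1 - r * (x \<bullet> x)))) =
        (\<Sum>i\<in>UNIV. of_real (h $ i) * (of_real (- 2 * r) * (of_real (x $ i) *
          (bump (k + 2) r x + (- of_nat k) * bump (k + 1) r x))))"
        unfolding D of_real_inner_vec sum_distrib_left sum_distrib_right by (simp only: mult_ac)
    qed
  qed
qed

text \<open>This class is closed under partial derivatives, so \<open>C_k k\<close> follows for all its members
  without computing higher derivatives.\<close>

inductive_set smooth_fns :: "(real ^ 'm::finite \<Rightarrow> complex) set" where
  const: "(\<lambda>x. c) \<in> smooth_fns"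
| coord: "(\<lambda>x. complex_of_real (x $ i)) \<in> smooth_fns"
| gexp: "gauss_exp w l \<in> smooth_fns"
| bump: "bump k r \<in> smooth_fns"
| add: "f \<in> smooth_fns \<Longrightarrow> g \<in> smooth_fns \<Longrightarrow> (\<lambda>x. f x + g x) \<in> smooth_fns"
| mult: "f \<in> smooth_fns \<Longrightarrow> g \<in> smooth_fns \<Longrightarrow> (\<lambda>x. f x * g x) \<in> smooth_fns"

lemma smooth_fns_has_partials:
  "f \<in> smooth_fns \<Longrightarrow> \<exists>f'. has_partials f f' \<and> (\<forall>i. f' i \<in> smooth_fns)"
proof (induction rule: smooth_fns.induct)
  case (const c)
  show ?case using has_partials_const smooth_fns.const by blast
next
  case (coord j)
  have "(\<lambda>x. if i = j then 1 else 0) \<in> smooth_fns" for i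
    by (rule smooth_fns.const)
  then show ?case using has_partials_coord[of j] by blast
next
  case (gexp w l)
  show ?case
    by (intro exI[of _ "\<lambda>i x. l * of_real (w $ i) * gauss_exp w l x"] conjI has_partials_gauss_exp allI smooth_fns.intros)
next
  case (bump k r)
  show ?case
    by (rule exI, rule conjI, rule has_partials_bump, intro allI smooth_fns.intros)
next
  case (add f g)
  then obtain f' g' where fg: "has_partials f f'" "has_partials g g'" "\<And>i. f' i \<in> smooth_fns" "\<And>i. g' i \<in> smooth_fns"
    by blast
  show ?case
    by (rule exI, rule conjI, rule has_partials_add[OF fg(1,2)]) (intro allI smooth_fns.intros fg)
next
  case (mult f g)
  then obtain f' g' where fg: "has_partials f f'" "has_partials g g'" "\<And>i. f' i \<in> smooth_fns" "\<And>i. g' i \<in> smooth_fns"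
    by blast
  show ?case
    by (rule exI, rule conjI, rule has_partials_mult[OF fg(1,2)]) (intro allI smooth_fns.intros fg mult.hyps)
qed

lemma smooth_fns_C_k: "f \<in> smooth_fns \<Longrightarrow> C_k k f"
proof (induction k arbitrary: f)
  case 0
  then obtain f' where "has_partials f f'" using smooth_fns_has_partials by blast
  then show ?case
    by (auto intro!: continuous_at_imp_continuous_on differentiable_imp_continuous_within has_partials_differentiable)
next
  case (Suc k)
  then obtain f' where f': "has_partials f f'" "\<And>i. f' i \<in> smooth_fns" using smooth_fns_has_partials by blast
  then show ?case using Suc.IH by (auto simp: has_partials_imp_partial has_partials_differentiable)
qed

lemma smooth_fns_measurable: "f \<in> smooth_fns \<Longrightarrow> f \<in> borel_measurable borel"
  using smooth_fns_C_k[of f 0] by (auto intro: borel_measurable_continuous_onI)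

text \<open>The factor \<open>exp 1\<close> normalizes the cutoff to tend to 1 as \<open>r\<close> tends to 0.\<close>

definition cutoff_exp :: "real ^ 'm::finite \<Rightarrow> complex \<Rightarrow> real \<Rightarrow> real ^ 'm \<Rightarrow> complex" where
  "cutoff_exp w l r x = of_real (exp 1) * (bump 0 r x * gauss_exp w l x)"

lemma cutoff_exp_smooth: "cutoff_exp w l r \<in> smooth_fns"
  unfolding cutoff_exp_def[abs_def] by (intro smooth_fns.intros)

lemma cutoff_exp_test_function:
  assumes "r > 0" shows "cutoff_exp w l r \<in> test_functions"
proof -
  have "{x. cutoff_exp w l r x \<noteq> 0} \<subseteq> cball 0 (1 / sqrt r)"
  proof
    fix x assume "x \<in> {x. cutoff_exp w l r x \<noteq> 0}"
    then have "1 - r * (x \<bullet> x) > 0" by (auto simp: cutoff_exp_def bump_def flat_exp_def split: if_splits)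
    then have "(norm x)\<^sup>2 * r \<le> 1" unfolding power2_norm_eq_inner by (simp only: mult.commute[of "x \<bullet> x"])
    then have "(norm x)\<^sup>2 \<le> 1 / r" using assms by (simp only: pos_le_divide_eq)
    also have "1 / r = (1 / sqrt r)\<^sup>2" using assms by (simp only: power_divide real_sqrt_pow2 less_imp_le one_power2)
    finally have "norm x \<le> 1 / sqrt r" by (rule power2_le_imp_le) (use assms in simp)
    then show "x \<in> cball 0 (1 / sqrt r)" by simp
  qed
  then have "bounded {x. cutoff_exp w l r x \<noteq> 0}" by (rule bounded_subset[OF bounded_cball])
  then show ?thesis by (auto simp: test_functions_def smooth_fns_C_k cutoff_exp_smooth)
qed

text \<open>Sorted so that the first term is the cutoff times the expected image of the exponential,
  while every other term carries a factor \<open>r\<close> and vanishes pointwise as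
  \<open>r\<close> tends to 0.\<close>

lemma ou_diff_cutoff_exp:
  fixes x :: "real ^ 'm::finite"
  assumes "norm w = 1"
  shows "ou_diff (cutoff_exp w l r) x = of_real (exp 1) * gauss_exp w l x *
     ((l\<^sup>2 - l * of_real (w \<bullet> x)) * bump 0 r x
      + of_real r * (of_real (2 * (x \<bullet> x) - 2 * real CARD('m)) - 4 * l * of_real (w \<bullet> x)) * bump 2 r x
      + of_real (4 * r\<^sup>2 * (x \<bullet> x)) * (bump 4 r x - 2 * bump 3 r x))"
proof -
  let ?E = "gauss_exp w l" and ?c = "complex_of_real (exp 1)"
  define X where "X i x = complex_of_real (x $ i)" for i and x :: "real ^ 'm"
  define W where "W i = complex_of_real (w $ i)" for i
  note hp = has_partials_const has_partials_add has_partials_mult has_partials_coord has_partials_gauss_exp has_partials_bump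
  have p1: "partial i (cutoff_exp w l r) = (\<lambda>x. ?c * ((of_real (- 2 * r) * (X i x * bump 2 r x)) * ?E x + bump 0 r x * (l * W i * ?E x)))" for i
  proof -
    have "partial i (cutoff_exp w l r) = (\<lambda>x. 0 * (bump 0 r x * ?E x) + ?c * ((of_real (- 2 * r) *
        (of_real (x $ i) * (bump (0 + 2) r x + (- of_nat 0) * bump (0 + 1) r x))) * ?E x + bump 0 r x * (l * of_real (w $ i) * ?E x)))"
      unfolding cutoff_exp_def[abs_def]
      by (rule has_partials_imp_partial) (intro hp)
    then show ?thesis by (simp add: X_def W_def numeral_2_eq_2)
  qed
  have p2: "partial i (partial i (cutoff_exp w l r)) x = ?c * ?E x * (of_real (- 2 * r) * bump 2 r x
     + of_real (4 * r\<^sup>2) * (X i x)\<^sup>2 * (bump 4 r x - 2 * bump 3 r x) + of_real (- 4 * r) * X i x * l * W i * bump 2 r x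
     + bump 0 r x * l\<^sup>2 * (W i)\<^sup>2)" for i x
  proof -
    note hp = has_partials_mult[OF has_partials_const has_partials_add[OF
          has_partials_mult[OF has_partials_mult[OF has_partials_const has_partials_mult[OF has_partials_coord has_partials_bump]]
              has_partials_gauss_exp]
          has_partials_mult[OF has_partials_bump has_partials_mult[OF has_partials_const has_partials_gauss_exp]]]]
    show ?thesis
      unfolding p1 X_def W_def fun_cong[OF has_partials_imp_partial[OF hp]]
      by (simp add: algebra_simps power2_eq_square eval_nat_numeral)
  qed
  have s: "(\<Sum>i\<in>UNIV. (W i)\<^sup>2) = 1" "(\<Sum>i\<in>UNIV. (X i x)\<^sup>2) = of_real (x \<bullet> x)"
     "(\<Sum>i\<in>UNIV. X i x * W i) = of_real (w \<bullet> x)"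
    using assms by (auto simp: W_def X_def inner_vec_def norm_eq_1 power2_eq_square mult.commute
       simp flip: of_real_mult of_real_sum)
  have "ou_diff (cutoff_exp w l r) x = (\<Sum>i\<in>UNIV. ?c * ?E x * (of_real (- 2 * r) * bump 2 r x
     + (of_real (4 * r\<^sup>2) * (bump 4 r x - 2 * bump 3 r x) + of_real (2 * r) * bump 2 r x) * (X i x)\<^sup>2
     + (of_real (- 4 * r) * l * bump 2 r x - l * bump 0 r x) * (X i x * W i)
     + bump 0 r x * l\<^sup>2 * (W i)\<^sup>2))"
    unfolding ou_diff_def p2 unfolding p1 X_def[symmetric] sum_subtractf[symmetric]
    by (rule sum.cong) (auto simp: algebra_simps power2_eq_square)
  also have "\<dots> = ?c * ?E x * (of_real (- 2 * r * real CARD('m)) * bump 2 r x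
     + (of_real (4 * r\<^sup>2) * (bump 4 r x - 2 * bump 3 r x) + of_real (2 * r) * bump 2 r x) * of_real (x \<bullet> x)
     + (of_real (- 4 * r) * l * bump 2 r x - l * bump 0 r x) * of_real (w \<bullet> x)
     + bump 0 r x * l\<^sup>2)"
    unfolding sum_distrib_left[symmetric] sum.distrib s by simp
  finally show ?thesis by (simp add: algebra_simps)
qed

section \<open>Bounds for exponentials and their cutoffs\<close>

lemma gauss_exp_measurable [measurable]: "gauss_exp w l \<in> borel_measurable borel"
  by (intro smooth_fns_measurable smooth_fns.intros)

lemma norm_gauss_exp: "cmod (gauss_exp w l x) = exp (Re l * (w \<bullet> x) - Re (l\<^sup>2) / 2)"
  by (simp add: gauss_exp_def)

lemma abs_inner_le_norm: "norm w = 1 \<Longrightarrow> \<bar>w \<bullet> x\<bar> \<le> norm x"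
  using Cauchy_Schwarz_ineq2[of w x] by simp

lemma norm_gauss_exp_le:
  assumes "norm w = 1" "cmod l \<le> B"
  shows "cmod (gauss_exp w l x) \<le> exp (B\<^sup>2 / 2) * exp (B * norm x)"
proof -
  have "\<bar>Re l * (w \<bullet> x)\<bar> \<le> B * norm x"
    unfolding abs_mult using assms abs_Re_le_cmod[of l] abs_inner_le_norm[of w x] by (intro mult_mono) auto
  moreover have "- Re (l\<^sup>2) \<le> B\<^sup>2"
    using abs_Re_le_cmod[of "l\<^sup>2"] power_mono[OF assms(2), of 2] by (auto simp: norm_power)
  ultimately show ?thesis unfolding norm_gauss_exp exp_add[symmetric] by simp
qed

lemma gauss_exp_l2:
  fixes w :: "real ^ 'm::finite"
  assumes "norm w = 1"
  shows "gauss_exp w l \<in> l2_space gauss_measure"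
  by (rule l2_space_gauss_exp_bound[OF _ norm_gauss_exp_le[OF assms order_refl]]) simp

lemma norm_bump_le: "cmod (bump k r x) \<le> fact k"
  using flat_exp_le[of k "1 - r * (x \<bullet> x)"] flat_exp_nonneg[of k] by (simp add: bump_def)

text \<open>Uniformity in \<open>r\<close> is the point: the right-hand side will dominate. The
  potentially large factor \<open>r * (x \<bullet> x)\<close> is at most 1 wherever a bump is
  nonzero. The constants come from \<open>norm_bump_le\<close>: the three terms contribute 1 and 8
  to the 9, and 148 is 4 from the second term plus 4 * 36 from the third, with 36 = 4! + 2 *
  3!.\<close>

lemma norm_ou_diff_cutoff_exp_le:
  fixes x :: "real ^ 'm::finite"
  assumes w: "norm w = 1" and r: "0 < r" "r \<le> 1"
  shows "cmod (ou_diff (cutoff_exp w l r) x) \<le>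
    exp 1 * ((cmod l)\<^sup>2 + 9 * cmod l + 148 + 4 * real CARD('m)) * exp ((cmod l)\<^sup>2 / 2) * exp ((cmod l + 1) * norm x)"
proof -
  define A1 where "A1 = (l\<^sup>2 - l * of_real (w \<bullet> x)) * bump 0 r x"
  define A2 where "A2 = of_real r * (of_real (2 * (x \<bullet> x) - 2 * real CARD('m)) - 4 * l * of_real (w \<bullet> x)) * bump 2 r x"
  define A3 where "A3 = of_real (4 * r\<^sup>2 * (x \<bullet> x)) * (bump 4 r x - 2 * bump 3 r x)"
  let ?N = "norm x"
  have lw: "cmod (l * of_real (w \<bullet> x)) \<le> cmod l * ?N"
    using abs_inner_le_norm[OF w, of x] by (simp add: norm_mult mult_left_mono)
  have b: "r * (x \<bullet> x) \<le> 1 \<or> bump k r x = 0" for k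
    by (auto simp: bump_def flat_exp_def)
  have "cmod A1 \<le> ((cmod l)\<^sup>2 + cmod l * ?N) * 1"
    unfolding A1_def norm_mult[of _ "bump 0 r x"]
  proof (rule mult_mono)
    show "cmod (l\<^sup>2 - l * complex_of_real (w \<bullet> x)) \<le> (cmod l)\<^sup>2 + cmod l * norm x"
      using norm_triangle_ineq4[of "l\<^sup>2" "l * complex_of_real (w \<bullet> x)"] lw by (simp add: norm_power)
    show "cmod (bump 0 r x) \<le> 1" using norm_bump_le[of 0 r x] by simp
  qed auto
  moreover have "cmod A2 \<le> (2 + 2 * real CARD('m) + 4 * (cmod l * ?N)) * 2"
  proof (cases "r * (x \<bullet> x) \<le> 1")
    case True
    have "cmod A2 = cmod (of_real r * (of_real (2 * (x \<bullet> x) - 2 * real CARD('m)) - 4 * l * of_real (w \<bullet> x))) * cmod (bump 2 r x)"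
      by (simp add: A2_def norm_mult)
    also have "\<dots> \<le> (2 + 2 * real CARD('m) + 4 * (cmod l * ?N)) * 2"
    proof (rule mult_mono)
      have "cmod (of_real r * (of_real (2 * (x \<bullet> x) - 2 * real CARD('m)) - 4 * l * of_real (w \<bullet> x)))
        = cmod (of_real (2 * (r * (x \<bullet> x))) - of_real (r * (2 * real CARD('m))) - of_real r * (4 * (l * of_real (w \<bullet> x))))"
        by (simp add: algebra_simps)
      also have "\<dots> \<le> cmod (of_real (2 * (r * (x \<bullet> x)))) + cmod (of_real (r * (2 * real CARD('m)))) + cmod (of_real r * (4 * (l * of_real (w \<bullet> x))))"
        by (intro order_trans[OF norm_triangle_ineq4] add_right_mono order_refl)
      also have "cmod (of_real (2 * (r * (x \<bullet> x)))) \<le> 2" using r True by (simp add: norm_mult)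
      also have "cmod (of_real (r * (2 * real CARD('m)))) \<le> 2 * real CARD('m)" using r by (simp add: norm_mult mult_left_le_one_le)
      also have "cmod (of_real r * (4 * (l * of_real (w \<bullet> x)))) \<le> 1 * (4 * (cmod l * ?N))"
        unfolding norm_mult[of "of_real r"] using r lw by (intro mult_mono) (auto simp: norm_mult)
      finally show "cmod (of_real r * (of_real (2 * (x \<bullet> x) - 2 * real CARD('m)) - 4 * l * of_real (w \<bullet> x))) \<le> 2 + 2 * real CARD('m) + 4 * (cmod l * ?N)"
        by simp
      show "cmod (bump 2 r x) \<le> 2" using norm_bump_le[of 2 r x] by (simp add: fact_numeral)
    qed auto
    finally show ?thesis .
  next
    case False
    then show ?thesis using b[of 2] by (simp add: A2_def)
  qed
  moreover have "cmod A3 \<le> 4 * 36"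
  proof (cases "r * (x \<bullet> x) \<le> 1")
    case True
    have "cmod A3 = 4 * (r * (r * (x \<bullet> x))) * cmod (bump 4 r x - 2 * bump 3 r x)"
      using r by (simp add: A3_def norm_mult power2_eq_square)
    also have "\<dots> \<le> 4 * 36"
    proof (rule mult_mono)
      show "4 * (r * (r * (x \<bullet> x))) \<le> 4" using r True by (simp add: mult_le_one)
      show "cmod (bump 4 r x - 2 * bump 3 r x) \<le> 36"
        using norm_triangle_ineq4[of "bump 4 r x" "2 * bump 3 r x"] norm_bump_le[of 4 r x] norm_bump_le[of 3 r x]
        by (simp add: fact_numeral)
    qed auto
    finally show ?thesis .
  next
    case False
    then show ?thesis using b[of 3] b[of 4] by (simp add: A3_def)
  qed
  ultimately have S: "cmod (A1 + A2 + A3) \<le> (cmod l)\<^sup>2 + 148 + 4 * real CARD('m) + 9 * (cmod l * ?N)"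
  proof -
    have "s \<le> q + 148 + 4 * m + 9 * p"
      if "a1 \<le> (q + p) * 1" "a2 \<le> (2 + 2 * m + 4 * p) * 2" "a3 \<le> 4 * 36" "s \<le> t + a3" "t \<le> a1 + a2"
      for s t a1 a2 a3 q p m :: real using that by (simp add: algebra_simps)
    then show "cmod A1 \<le> ((cmod l)\<^sup>2 + cmod l * ?N) * 1 \<Longrightarrow>
       cmod A2 \<le> (2 + 2 * real CARD('m) + 4 * (cmod l * ?N)) * 2 \<Longrightarrow> cmod A3 \<le> 4 * 36 \<Longrightarrow> ?thesis"
      using norm_triangle_ineq[of "A1 + A2" A3] norm_triangle_ineq[of A1 A2] by blast
  qed
  define c1 where "c1 = (cmod l)\<^sup>2 + 148 + 4 * real CARD('m)"
  \<comment> \<open>Both 1 and \<open>norm x\<close> are at most \<open>exp (norm x)\<close>; this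
    costs the additional 1 in the exponent \<open>cmod l + 1\<close>.\<close>
  have "c1 * 1 + 9 * cmod l * ?N \<le> c1 * exp ?N + 9 * cmod l * exp ?N"
    using exp_ge_add_one_self[of ?N] by (intro add_mono mult_left_mono) (auto simp: c1_def simp del: exp_ge_add_one_self)
  with S have S: "cmod (A1 + A2 + A3) \<le> ((cmod l)\<^sup>2 + 9 * cmod l + 148 + 4 * real CARD('m)) * exp ?N"
    by (simp add: c1_def algebra_simps)
  have "cmod (ou_diff (cutoff_exp w l r) x) = exp 1 * cmod (gauss_exp w l x) * cmod (A1 + A2 + A3)"
    by (simp add: ou_diff_cutoff_exp[OF w] A1_def A2_def A3_def norm_mult)
  also have "\<dots> \<le> exp 1 * (exp ((cmod l)\<^sup>2 / 2) * exp (cmod l * ?N)) * (((cmod l)\<^sup>2 + 9 * cmod l + 148 + 4 * real CARD('m)) * exp ?N)"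
    by (intro mult_mono S norm_gauss_exp_le w order_refl) auto
  finally show ?thesis by (simp add: algebra_simps exp_add)
qed

text \<open>Smooth cutoffs at radius growing to infinity converge in L2 together with their images,
  by dominated convergence with the uniform bounds; this is membership in the closure.\<close>

lemma gauss_exp_in_ou_operator:
  fixes w :: "real ^ 'm::finite"
  assumes w: "norm w = 1"
  shows "(gauss_exp w l, \<lambda>x. (l\<^sup>2 - l * of_real (w \<bullet> x)) * gauss_exp w l x) \<in> ou_operator"
proof -
  define g where "g x = (l\<^sup>2 - l * of_real (w \<bullet> x)) * gauss_exp w l x" for x
  have gm [measurable]: "g \<in> borel_measurable borel" unfolding g_def[abs_def] by measurable
  define K where "K = exp 1 * ((cmod l)\<^sup>2 + 9 * cmod l + 148 + 4 * real CARD('m)) * exp ((cmod l)\<^sup>2 / 2)"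
  define r where "r n = 1 / real (Suc n)" for n
  have r: "0 < r n" "r n \<le> 1" for n by (auto simp: r_def)
  have r0: "r \<longlonglongrightarrow> 0" unfolding r_def[abs_def] by (rule LIMSEQ_Suc[OF lim_inverse_n'])
  \<comment> \<open>The limit is the same for every \<open>k\<close>, because
    \<open>flat_exp k 1 = exp (- 1)\<close>; the factor \<open>exp 1\<close> in
    \<open>cutoff_exp\<close> compensates it.\<close>
  have bump_lim: "(\<lambda>n. bump k (r n) x) \<longlonglongrightarrow> of_real (exp (-1))" for k and x :: "real ^ 'm"
  proof -
    have "isCont (flat_exp k) 1" using flat_exp_has_derivative by (rule DERIV_isCont)
    moreover have "(\<lambda>n. 1 - r n * (x \<bullet> x)) \<longlonglongrightarrow> 1 - 0 * (x \<bullet> x)" by (intro tendsto_intros r0)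
    ultimately have "(\<lambda>n. flat_exp k (1 - r n * (x \<bullet> x))) \<longlonglongrightarrow> flat_exp k 1"
      by (auto intro: isCont_tendsto_compose)
    then show ?thesis unfolding bump_def by (intro tendsto_of_real) (simp add: flat_exp_def)
  qed
  have lim_u: "(\<lambda>n. cutoff_exp w l (r n) x) \<longlonglongrightarrow> gauss_exp w l x" for x
  proof -
    have "(\<lambda>n. cutoff_exp w l (r n) x) \<longlonglongrightarrow> of_real (exp 1) * (of_real (exp (-1)) * gauss_exp w l x)"
      unfolding cutoff_exp_def by (intro tendsto_intros bump_lim)
    then show ?thesis by (simp add: mult.assoc[symmetric] flip: of_real_mult exp_add)
  qed
  have lim_g: "(\<lambda>n. ou_diff (cutoff_exp w l (r n)) x) \<longlonglongrightarrow> g x" for x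
  proof -
    have "(\<lambda>n. ou_diff (cutoff_exp w l (r n)) x) \<longlonglongrightarrow> of_real (exp 1) * gauss_exp w l x *
     ((l\<^sup>2 - l * of_real (w \<bullet> x)) * of_real (exp (-1))
      + of_real 0 * (of_real (2 * (x \<bullet> x) - 2 * real CARD('m)) - 4 * l * of_real (w \<bullet> x)) * of_real (exp (-1))
      + of_real (4 * 0\<^sup>2 * (x \<bullet> x)) * (of_real (exp (-1)) - 2 * of_real (exp (-1))))"
      unfolding ou_diff_cutoff_exp[OF w] by (intro tendsto_intros bump_lim r0)
    moreover have "of_real (exp 1) * gauss_exp w l x *
     ((l\<^sup>2 - l * of_real (w \<bullet> x)) * of_real (exp (-1))
      + of_real 0 * (of_real (2 * (x \<bullet> x) - 2 * real CARD('m)) - 4 * l * of_real (w \<bullet> x)) * of_real (exp (-1))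
      + of_real (4 * 0\<^sup>2 * (x \<bullet> x)) * (of_real (exp (-1)) - 2 * of_real (exp (-1)))) = of_real (exp 1 * exp (-1)) * g x"
      unfolding of_real_mult by (simp add: g_def)
    moreover have "exp 1 * exp (-1) = (1::real)" by (simp flip: exp_add)
    ultimately show ?thesis by (simp only: of_real_1 mult_1)
  qed
  have [measurable]: "(bump k r :: real ^ 'm \<Rightarrow> complex) \<in> borel_measurable borel" for k r
    by (intro smooth_fns_measurable smooth_fns.intros)
  have ou_m [measurable]: "ou_diff (cutoff_exp w l (r n)) \<in> borel_measurable borel" for n
    unfolding ou_diff_cutoff_exp[OF w, abs_def] by measurable
  have cut_m [measurable]: "cutoff_exp w l (r n) \<in> borel_measurable borel" for n
    by (rule smooth_fns_measurable[OF cutoff_exp_smooth])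
  have g_le: "cmod (g x) \<le> K * exp ((cmod l + 1) * norm x)" for x
    by (rule LIMSEQ_le_const2[OF tendsto_norm[OF lim_g]])
       (use norm_ou_diff_cutoff_exp_le[OF w r] in \<open>auto simp: K_def\<close>)
  have cut_le: "cmod (cutoff_exp w l (r n) x) \<le> (exp 1 * exp ((cmod l)\<^sup>2 / 2)) * exp (cmod l * norm x)" for n x
  proof -
    have "cmod (cutoff_exp w l (r n) x) = exp 1 * (cmod (bump 0 (r n) x) * cmod (gauss_exp w l x))"
      by (simp add: cutoff_exp_def norm_mult)
    also have "\<dots> \<le> exp 1 * (1 * (exp ((cmod l)\<^sup>2 / 2) * exp (cmod l * norm x)))"
      using norm_bump_le[of 0] by (intro mult_left_mono mult_mono norm_gauss_exp_le[OF w]) auto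
    finally show ?thesis by simp
  qed
  have "(\<lambda>n. sq_int gauss_measure (\<lambda>x. cutoff_exp w l (r n) x - gauss_exp w l x)) \<longlonglongrightarrow> 0"
  proof (rule sq_int_dominated_convergence[OF _ _ _ integrable_gauss_exp_norm_sq])
    show "AE x in gauss_measure. cmod (cutoff_exp w l (r n) x) \<le> (exp 1 * exp ((cmod l)\<^sup>2 / 2)) * exp (cmod l * norm x)" for n
      using cut_le by auto
    show "AE x in gauss_measure. cmod (gauss_exp w l x) \<le> (exp 1 * exp ((cmod l)\<^sup>2 / 2)) * exp (cmod l * norm x)"
      by (intro AE_I2 LIMSEQ_le_const2[OF tendsto_norm[OF lim_u]]) (use cut_le in auto)
  qed (use lim_u in auto)
  moreover have "(\<lambda>n. sq_int gauss_measure (\<lambda>x. ou_diff (cutoff_exp w l (r n)) x - g x)) \<longlonglongrightarrow> 0"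
  proof (rule sq_int_dominated_convergence[OF _ _ _ integrable_gauss_exp_norm_sq])
    show "AE x in gauss_measure. cmod (ou_diff (cutoff_exp w l (r n)) x) \<le> K * exp ((cmod l + 1) * norm x)" for n
      using norm_ou_diff_cutoff_exp_le[OF w r] by (auto simp: K_def)
    show "AE x in gauss_measure. cmod (g x) \<le> K * exp ((cmod l + 1) * norm x)" using g_le by auto
  qed (use lim_g in auto)
  moreover have "g \<in> l2_space gauss_measure" by (rule l2_space_gauss_exp_bound[OF gm g_le])
  ultimately show ?thesis
    unfolding g_def[abs_def] ou_operator_def l2_norm_tendsto_0_iff
    using gauss_exp_l2[OF w, of l] cutoff_exp_test_function[OF r(1)]
    by (auto intro!: exI[of _ "\<lambda>n. cutoff_exp w l (r n)"])
qed

section \<open>Differentiation of the exponentials in the parameter\<close>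

lemma gauss_exp_has_field_derivative:
  "((\<lambda>l. gauss_exp w l x) has_field_derivative (of_real (w \<bullet> x) - l) * gauss_exp w l x) (at l within S)"
  unfolding gauss_exp_def by (auto intro!: derivative_eq_intros simp: algebra_simps)

lemma norm_gauss_exp_deriv_le:
  assumes w: "norm w = 1" and z: "cmod z \<le> B"
  shows "cmod ((of_real (w \<bullet> x) - z) * gauss_exp w z x) \<le> (1 + B) * exp (B\<^sup>2 / 2) * exp ((B + 1) * norm x)"
proof -
  have B0: "0 \<le> B" using z norm_ge_zero order_trans by blast
    have "cmod (of_real (w \<bullet> x) - z) \<le> norm x + B"
      using norm_triangle_ineq4[of "of_real (w \<bullet> x)" z] abs_inner_le_norm[OF w, of x] z by simp
    also have "\<dots> \<le> (1 + B) * exp (norm x)"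
    proof -
      have "norm x \<le> exp (norm x)" using exp_ge_add_one_self[of "norm x"] by linarith
      then show ?thesis using mult_left_mono[of 1 "exp (norm x)" B] B0 by (simp add: algebra_simps)
    qed
    finally have "cmod ((of_real (w \<bullet> x) - z) * gauss_exp w z x) \<le> ((1 + B) * exp (norm x)) * (exp (B\<^sup>2 / 2) * exp (B * norm x))"
      unfolding norm_mult by (intro mult_mono norm_gauss_exp_le[OF w z]) (use B0 in auto)
    then show ?thesis by (simp add: algebra_simps exp_add)
qed

text \<open>The denominators \<open>D\<close> are kept separate from \<open>Z n - l\<close> so that
  one statement serves two derivatives: in time, with real increments and a moving parameter, and in
  the complex parameter itself.\<close>

lemma gauss_exp_diff_quotient:
  fixes w :: "real ^ 'm::finite"
  assumes w: "norm w = 1" and Z: "Z \<longlonglongrightarrow> l" and D: "(\<lambda>n. (Z n - l) / D n) \<longlonglongrightarrow> d"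
  shows "(\<lambda>n. sq_int gauss_measure (\<lambda>x. (gauss_exp w (Z n) x - gauss_exp w l x) / D n
            - d * ((of_real (w \<bullet> x) - l) * gauss_exp w l x))) \<longlonglongrightarrow> 0"
proof -
  obtain B where B: "\<And>n. cmod (Z n) \<le> B" "cmod l \<le> B"
    using convergent_imp_Bseq[OF convergentI[OF Z]] LIMSEQ_le_const2[OF tendsto_norm[OF Z]]
    unfolding Bseq_def by meson
  obtain B' where B': "\<And>n. cmod ((Z n - l) / D n) \<le> B'" "cmod d \<le> B'"
    using convergent_imp_Bseq[OF convergentI[OF D]] LIMSEQ_le_const2[OF tendsto_norm[OF D]]
    unfolding Bseq_def by meson
  have B0: "0 \<le> B" "0 \<le> B'" using B(2) B'(2) norm_ge_zero order_trans by blast+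
  define G where "G x = ((1 + B) * exp (B\<^sup>2 / 2) * B') * exp ((B + 1) * norm x)" for x :: "real ^ 'm"
  note dE = norm_gauss_exp_deriv_le[OF w]
  show ?thesis
  proof (rule sq_int_dominated_convergence[where G = G])
    show "integrable gauss_measure (\<lambda>x. (G x)\<^sup>2)"
      unfolding G_def by (rule integrable_gauss_exp_norm_sq)
    show "AE x in gauss_measure. cmod ((gauss_exp w (Z n) x - gauss_exp w l x) / D n) \<le> G x" for n
    proof (rule AE_I2)
      fix x
      \<comment> \<open>Mean value estimate on a ball containing all the parameters, so the
        dominating function does not depend on \<open>n\<close>.\<close>
      have "cmod (gauss_exp w (Z n) x - gauss_exp w l x) \<le> ((1 + B) * exp (B\<^sup>2 / 2) * exp ((B + 1) * norm x)) * cmod (Z n - l)"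
        by (rule field_differentiable_bound[where S = "cball 0 B", OF _ gauss_exp_has_field_derivative])
           (use B dE in auto)
      then have "cmod ((gauss_exp w (Z n) x - gauss_exp w l x) / D n) \<le> ((1 + B) * exp (B\<^sup>2 / 2) * exp ((B + 1) * norm x)) * cmod ((Z n - l) / D n)"
        by (simp add: norm_divide divide_right_mono)
      also have "\<dots> \<le> ((1 + B) * exp (B\<^sup>2 / 2) * exp ((B + 1) * norm x)) * B'"
        using B' B0 by (intro mult_left_mono) auto
      finally show "cmod ((gauss_exp w (Z n) x - gauss_exp w l x) / D n) \<le> G x"
        by (simp add: G_def mult_ac)
    qed
    show "AE x in gauss_measure. cmod (d * ((of_real (w \<bullet> x) - l) * gauss_exp w l x)) \<le> G x"
    proof (rule AE_I2)
      fix x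
      have "cmod (d * ((of_real (w \<bullet> x) - l) * gauss_exp w l x)) \<le> B' * ((1 + B) * exp (B\<^sup>2 / 2) * exp ((B + 1) * norm x))"
        unfolding norm_mult[of d] by (intro mult_mono dE B B') (use B0 in auto)
      then show "cmod (d * ((of_real (w \<bullet> x) - l) * gauss_exp w l x)) \<le> G x" by (simp add: G_def mult_ac)
    qed
    show "AE x in gauss_measure. (\<lambda>n. (gauss_exp w (Z n) x - gauss_exp w l x) / D n)
        \<longlonglongrightarrow> d * ((of_real (w \<bullet> x) - l) * gauss_exp w l x)"
    proof (rule AE_I2)
      fix x
      \<comment> \<open>Caratheodory's slope function replaces division by \<open>Z n - l\<close>,
        which may be 0, for instance when the moving parameter is constantly 0.\<close>
      obtain g where g: "\<And>z. gauss_exp w z x - gauss_exp w l x = g z * (z - l)" "isCont g l"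
         "g l = (of_real (w \<bullet> x) - l) * gauss_exp w l x"
        using gauss_exp_has_field_derivative[of w x l UNIV] unfolding CARAT_DERIV by auto
      have "(\<lambda>n. g (Z n) * ((Z n - l) / D n)) \<longlonglongrightarrow> g l * d"
        by (intro tendsto_mult D isCont_tendsto_compose[OF g(2) Z])
      then show "(\<lambda>n. (gauss_exp w (Z n) x - gauss_exp w l x) / D n) \<longlonglongrightarrow> d * ((of_real (w \<bullet> x) - l) * gauss_exp w l x)"
        by (simp add: g mult.commute)
    qed
  qed (auto simp: G_def[abs_def])
qed

section \<open>Evolution of the exponential transform\<close>

lemma sq_int_unitary:
  assumes "l2_unitary M V" "f \<in> l2_space M"
  shows "sq_int M (V f) = sq_int M f"
proof -
  have V: "V f \<in> l2_space M" "l2_inner M (V f) (V f) = l2_inner M f f"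
    using assms by (auto simp: l2_unitary_def)
  have "l2_inner M f f = of_real (\<integral>x. (cmod (f x))\<^sup>2 \<partial>M)" for f
    unfolding l2_inner_def by (simp add: complex_norm_square[symmetric] del: of_real_power)
  then have "complex_of_real (\<integral>x. (cmod (V f x))\<^sup>2 \<partial>M) = of_real (\<integral>x. (cmod (f x))\<^sup>2 \<partial>M)"
    using V(2) by metis
  then have "(\<integral>x. (cmod (V f x))\<^sup>2 \<partial>M) = (\<integral>x. (cmod (f x))\<^sup>2 \<partial>M)" by (simp only: of_real_eq_iff)
  then show ?thesis using sq_int_eq[OF V(1)] sq_int_eq[OF assms(2)] by simp
qed

lemma l2_inner_cong_AE:
  assumes "f \<in> l2_space M" "f' \<in> l2_space M" "g \<in> l2_space M" "g' \<in> l2_space M"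
    and "AE x in M. f x = f' x" "AE x in M. g x = g' x"
  shows "l2_inner M f g = l2_inner M f' g'"
  unfolding l2_inner_def
proof (rule integral_cong_AE)
  show "(\<lambda>x. f x * cnj (g x)) \<in> borel_measurable M" "(\<lambda>x. f' x * cnj (g' x)) \<in> borel_measurable M"
    using l2_inner_integrable assms(1-4) by (auto intro: borel_measurable_integrable)
qed (use assms(5,6) in eventually_elim, simp)

lemma l2_inner_diff_right:
  assumes "f \<in> l2_space M" "g \<in> l2_space M" "h \<in> l2_space M"
  shows "l2_inner M f (\<lambda>x. g x - h x) = l2_inner M f g - l2_inner M f h"
  unfolding l2_inner_def
  by (simp add: right_diff_distrib Bochner_Integration.integral_diff l2_inner_integrable assms)

lemma l2_inner_diff_left:
  assumes "f \<in> l2_space M" "g \<in> l2_space M" "h \<in> l2_space M"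
  shows "l2_inner M (\<lambda>x. f x - g x) h = l2_inner M f h - l2_inner M g h"
  unfolding l2_inner_def
  by (simp add: left_diff_distrib Bochner_Integration.integral_diff l2_inner_integrable assms)

lemma l2_inner_mult_left: "l2_inner M (\<lambda>x. c * f x) h = c * l2_inner M f h"
  unfolding l2_inner_def by (simp add: mult.assoc)

lemma l2_inner_commute: "l2_inner M g f = cnj (l2_inner M f g)"
proof -
  have "cnj (l2_inner M f g) = (\<integral>x. cnj (f x * cnj (g x)) \<partial>M)"
    unfolding l2_inner_def by (rule Bochner_Integration.integral_cnj[symmetric])
  then show ?thesis by (simp add: l2_inner_def mult.commute)
qed

text \<open>Cauchy-Schwarz, with the first argument allowed to vary as long as it stays bounded;
  along the group it does so by unitarity.\<close>

lemma l2_inner_tendsto_0: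
  assumes f: "\<And>h. f h \<in> l2_space M" "\<And>h. sq_int M (f h) \<le> C" "C < \<infinity>"
    and q: "\<And>h. q h \<in> l2_space M" "((\<lambda>h. sq_int M (q h)) \<longlongrightarrow> 0) F"
  shows "((\<lambda>h. l2_inner M (f h) (q h)) \<longlongrightarrow> 0) F"
proof -
  have "((\<lambda>h. ennreal ((cmod (l2_inner M (f h) (q h)))\<^sup>2)) \<longlongrightarrow> 0) F"
  proof (rule tendsto_sandwich[OF _ _ tendsto_const])
    show "\<forall>\<^sub>F h in F. ennreal ((cmod (l2_inner M (f h) (q h)))\<^sup>2) \<le> C * sq_int M (q h)"
      by (intro always_eventually allI order_trans[OF l2_inner_cauchy_schwarz] mult_right_mono f q) auto
    have "((\<lambda>h. C * sq_int M (q h)) \<longlongrightarrow> C * 0) F"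
      using f(3) by (intro tendsto_mult_ennreal tendsto_const q) auto
    then show "((\<lambda>h. C * sq_int M (q h)) \<longlongrightarrow> 0) F" by simp
  qed auto
  then have "((\<lambda>h. enn2real (ennreal ((cmod (l2_inner M (f h) (q h)))\<^sup>2))) \<longlongrightarrow> enn2real 0) F"
    by (intro tendsto_enn2real) auto
  then have "((\<lambda>h. sqrt ((cmod (l2_inner M (f h) (q h)))\<^sup>2)) \<longlongrightarrow> sqrt 0) F"
    by (intro tendsto_real_sqrt) simp
  then show ?thesis by (simp add: tendsto_norm_zero_iff)
qed

text \<open>Since \<open>U (t + h) \<phi> = U h (U t \<phi>)\<close>, the increment of the inner product equals
  \<open>l2_inner M (U (t + h) \<phi>) (v (t + h) - U h (v t))\<close>, which is \<open>o(h)\<close> although \<open>\<phi>\<close>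
  need not be in the domain of the generator.\<close>

lemma unitary_group_inner_const:
  assumes ug: "unitary_group M U" and phi: "\<phi> \<in> l2_space M"
    and gen: "\<And>t. (v t, g t) \<in> generator M U"
    and deriv: "\<And>t. ((\<lambda>h. sq_int M (\<lambda>x. (v (t + h) x - v t x) / of_real h - g t x)) \<longlongrightarrow> 0) (at 0)"
  shows "l2_inner M (U t \<phi>) (v t) = l2_inner M (U r \<phi>) (v r)"
proof -
  define k where "k t = l2_inner M (U t \<phi>) (v t)" for t
  have un: "l2_unitary M (U t)" for t using ug by (simp add: unitary_group_def)
  have Ul2: "U t f \<in> l2_space M" if "f \<in> l2_space M" for t f
    using un that by (auto simp: l2_unitary_def)
  have inn: "l2_inner M (U t f) (U t h) = l2_inner M f h" if "f \<in> l2_space M" "h \<in> l2_space M" for t f h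
    using un that by (auto simp: l2_unitary_def)
  have v: "v t \<in> l2_space M" "g t \<in> l2_space M" for t using gen[of t] by (auto simp: generator_def)
  define q where "q t h = (\<lambda>x. (v (t + h) x - U h (v t) x) / complex_of_real h)" for t h
  have ql2: "q t h \<in> l2_space M" for t h
    using l2_space_mult_const[OF l2_space_diff[OF v(1) Ul2[OF v(1)]], of "1 / complex_of_real h" "t + h" h t]
    by (simp add: q_def)
  have diff: "(k (t + h) - k t) / of_real h = l2_inner M (U (t + h) \<phi>) (q t h)" for t h
  proof -
    have "k t = l2_inner M (U h (U t \<phi>)) (U h (v t))"
      unfolding k_def by (rule inn[symmetric]) (intro Ul2 phi v)+
    also have "\<dots> = l2_inner M (U (t + h) \<phi>) (U h (v t))"
    proof (rule l2_inner_cong_AE)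
      have "AE x in M. U (h + t) \<phi> x = U h (U t \<phi>) x" using ug phi by (simp add: unitary_group_def)
      then show "AE x in M. U h (U t \<phi>) x = U (t + h) \<phi> x" by (simp add: add.commute eq_commute)
    qed (intro Ul2 phi v AE_I2 refl)+
    finally have "k (t + h) - k t = l2_inner M (U (t + h) \<phi>) (\<lambda>x. v (t + h) x - U h (v t) x)"
      by (simp add: l2_inner_diff_right Ul2 phi v k_def)
    then show ?thesis by (simp add: l2_inner_def q_def)
  qed
  have qlim: "((\<lambda>h. sq_int M (q t h)) \<longlongrightarrow> 0) (at 0)" for t
  proof (rule tendsto_sandwich[OF _ _ tendsto_const])
    \<comment> \<open>\<open>q t h\<close> is the difference of two quotients, that of the curve
      \<open>v\<close> and that of the group orbit of \<open>v t\<close>. Both tend to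
      \<open>g t\<close>, so their errors \<open>q1\<close> and \<open>q2\<close> control
      it.\<close>
    define q1 where "q1 h = (\<lambda>x. (v (t + h) x - v t x) / complex_of_real h - g t x)" for h
    define q2 where "q2 h = (\<lambda>x. (U h (v t) x - v t x) / complex_of_real h - g t x)" for h
    have q12: "q1 h \<in> l2_space M" "q2 h \<in> l2_space M" for h
      using l2_space_diff[OF l2_space_mult_const[OF l2_space_diff[OF v(1)[of "t + h"] v(1)[of t]], of "1 / of_real h"] v(2)[of t]]
        l2_space_diff[OF l2_space_mult_const[OF l2_space_diff[OF Ul2[OF v(1)[of t], of h] v(1)[of t]], of "1 / of_real h"] v(2)[of t]]
      by (simp_all add: q1_def q2_def)
    have le: "sq_int M (q t h) \<le> 2 * sq_int M (q1 h) + 2 * sq_int M (q2 h)" for h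
    proof -
      have "sq_int M (\<lambda>x. q1 h x + (- 1) * q2 h x) \<le> 2 * sq_int M (q1 h) + 2 * sq_int M (\<lambda>x. (- 1) * q2 h x)"
        by (intro sq_int_add_le l2_space_measurable q12 l2_space_mult_const)
      moreover have "q t h x = q1 h x + (- 1) * q2 h x" for x
        by (simp add: q_def q1_def q2_def diff_divide_distrib)
      ultimately show ?thesis by simp
    qed
    then show "\<forall>\<^sub>F h in at 0. sq_int M (q t h) \<le> 2 * sq_int M (q1 h) + 2 * sq_int M (q2 h)" by simp
    have "((\<lambda>h. sq_int M (q1 h)) \<longlongrightarrow> 0) (at 0)" using deriv by (simp add: q1_def)
    moreover have "((\<lambda>h. sq_int M (q2 h)) \<longlongrightarrow> 0) (at 0)"
      using gen[of t] by (simp add: generator_def q2_def l2_norm_tendsto_0_iff)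
    ultimately have "((\<lambda>h. 2 * sq_int M (q1 h) + 2 * sq_int M (q2 h)) \<longlongrightarrow> 2 * 0 + 2 * 0) (at 0)"
      by (intro tendsto_add tendsto_mult_ennreal tendsto_const) auto
    then show "((\<lambda>h. 2 * sq_int M (q1 h) + 2 * sq_int M (q2 h)) \<longlongrightarrow> 0) (at 0)" by simp
  qed auto
  have "(k has_derivative (\<lambda>h. 0)) (at t)" for t
  proof -
    have "((\<lambda>h. (k (t + h) - k t) / of_real h) \<longlongrightarrow> 0) (at 0)"
      unfolding diff
    proof (rule l2_inner_tendsto_0[where C = "sq_int M \<phi>"])
      show "sq_int M (U (t + h) \<phi>) \<le> sq_int M \<phi>" for h using sq_int_unitary[OF un phi] by simp
    qed (simp_all add: Ul2 phi ql2 qlim sq_int_eq[OF phi])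
    then have "((\<lambda>h. norm ((k (t + h) - k t) / of_real h)) \<longlongrightarrow> 0) (at 0)" by (rule tendsto_norm_zero)
    then have "((\<lambda>h. norm (k (t + h) - k t - 0) / norm h) \<longlongrightarrow> 0) (at 0)"
      by (simp add: norm_divide)
    then show ?thesis by (simp add: has_derivative_at)
  qed
  then show ?thesis
    unfolding k_def[symmetric] by (intro has_derivative_zero_unique[of UNIV]) (auto intro: has_derivative_at_withinI)
qed

text \<open>The curve \<open>v\<close> of exponentials with rotating parameter solves the same
  evolution equation as the group: \<open>c\<close> has derivative \<open>- \<i> * c t\<close>, and
  \<open>- c t\<close> times the parameter derivative of the exponential is its image under the
  operator. Its inner product with the orbit of \<phi> is therefore constant.\<close>

lemma gauss_exp_evolution:
  fixes w :: "real ^ 'm::finite"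
  assumes U: "is_exp_it gauss_measure ou_operator U" and phi: "\<phi> \<in> l2_space gauss_measure" and w: "norm w = 1"
  shows "(\<integral>x. U t \<phi> x * gauss_exp w (exp (\<i> * of_real t) * l) x \<partial>gauss_measure)
       = (\<integral>x. U 0 \<phi> x * gauss_exp w l x \<partial>gauss_measure)"
proof -
  \<comment> \<open>Conjugated because \<open>l2_inner\<close> conjugates its second argument; the
    integrals in the claim do not.\<close>
  define c where "c t = exp (- \<i> * of_real t) * cnj l" for t :: real
  define v where "v t = gauss_exp w (c t)" for t
  define g where "g t x = \<i> * (((c t)\<^sup>2 - c t * of_real (w \<bullet> x)) * gauss_exp w (c t) x)" for t and x :: "real ^ 'm"
  have cnjE: "cnj (gauss_exp w z x) = gauss_exp w (cnj z) x" for z x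
    by (simp add: gauss_exp_def exp_cnj)
  have "l2_inner gauss_measure (U t \<phi>) (v t) = l2_inner gauss_measure (U 0 \<phi>) (v 0)"
  proof (rule unitary_group_inner_const[OF _ phi, where g = g])
    show "unitary_group gauss_measure U" using U by (simp add: is_exp_it_def)
    have gen: "generator gauss_measure U = {(f, \<lambda>x. \<i> * g x) | f g. (f, g) \<in> ou_operator}"
      using U by (simp add: is_exp_it_def)
    show "(v t, g t) \<in> generator gauss_measure U" for t
      unfolding gen v_def g_def[abs_def]
      by (intro CollectI exI conjI) (rule refl, rule gauss_exp_in_ou_operator[OF w])
    show "((\<lambda>h. sq_int gauss_measure (\<lambda>x. (v (t + h) x - v t x) / complex_of_real h - g t x)) \<longlongrightarrow> 0) (at 0)" for t
      unfolding tendsto_at_iff_sequentially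
    proof (intro allI impI)
      fix X assume X: "\<forall>i. X i \<in> UNIV - {0}" "X \<longlonglongrightarrow> (0::real)"
      have cd: "((\<lambda>z. exp (- \<i> * z) * cnj l) has_field_derivative exp (- \<i> * of_real t) * (- \<i> * 1) * cnj l) (at (of_real t))"
        by (intro DERIV_cmult_right DERIV_chain2[OF DERIV_exp] DERIV_cmult DERIV_ident)
      have "(\<lambda>n. complex_of_real t + of_real (X n)) \<longlonglongrightarrow> of_real t + of_real 0"
        by (intro tendsto_intros X)
      then have "filterlim (\<lambda>n. complex_of_real t + of_real (X n)) (at (of_real t)) sequentially"
        using X(1) by (simp add: filterlim_at)
      from filterlim_compose[OF cd[unfolded has_field_derivative_iff] this]
      have "(\<lambda>n. (c (t + X n) - c t) / of_real (X n)) \<longlonglongrightarrow> - \<i> * c t"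
        by (simp add: c_def mult_ac)
      moreover have "(\<lambda>n. c (t + X n)) \<longlonglongrightarrow> c t"
      proof -
        have "isCont c t" unfolding c_def by (intro continuous_intros)
        moreover have "(\<lambda>n. t + X n) \<longlonglongrightarrow> t + 0" by (intro tendsto_intros X)
        ultimately show ?thesis by (auto intro: isCont_tendsto_compose)
      qed
      ultimately have "(\<lambda>n. sq_int gauss_measure (\<lambda>x. (gauss_exp w (c (t + X n)) x - gauss_exp w (c t) x) / of_real (X n)
            - (- \<i> * c t) * ((of_real (w \<bullet> x) - c t) * gauss_exp w (c t) x))) \<longlonglongrightarrow> 0"
        by (intro gauss_exp_diff_quotient[OF w])
      moreover have "(- \<i> * c t) * ((of_real (w \<bullet> x) - c t) * gauss_exp w (c t) x) = g t x" for x
        by (simp add: g_def algebra_simps power2_eq_square)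
      ultimately show "((\<lambda>h. sq_int gauss_measure (\<lambda>x. (v (t + h) x - v t x) / complex_of_real h - g t x)) \<circ> X) \<longlonglongrightarrow> 0"
        unfolding o_def v_def by (simp only:)
    qed
  qed
  then show ?thesis
    by (simp add: l2_inner_def v_def cnjE c_def exp_cnj)
qed

text \<open>The transform is a continuous functional applied to exponentials whose difference
  quotients converge in L2, so no differentiation under the integral is needed.\<close>

lemma holomorphic_gauss_exp_transform:
  fixes w :: "real ^ 'm::finite"
  assumes phi: "\<phi> \<in> l2_space gauss_measure" and w: "norm w = 1"
  shows "(\<lambda>l. \<integral>x. \<phi> x * gauss_exp w l x \<partial>gauss_measure) holomorphic_on UNIV"
proof -
  define dE where "dE l x = (of_real (w \<bullet> x) - l) * gauss_exp w l x" for l and x :: "real ^ 'm"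
  define F where "F l = (\<integral>x. \<phi> x * gauss_exp w l x \<partial>gauss_measure)" for l
  have E: "gauss_exp w l \<in> l2_space gauss_measure" for l by (rule gauss_exp_l2[OF w])
  define cphi where "cphi x = cnj (\<phi> x)" for x
  have "cphi \<in> borel_measurable gauss_measure"
    unfolding cphi_def[abs_def]
    by (rule borel_measurable_continuous_on[OF _ l2_space_measurable[OF phi]]) (intro continuous_intros)
  then have cphi: "cphi \<in> l2_space gauss_measure"
    by (rule l2_spaceI_bounded[OF phi, where C = 1]) (simp add: cphi_def)
  have F: "F l = l2_inner gauss_measure (gauss_exp w l) cphi" for l
    by (simp add: F_def l2_inner_def cphi_def mult.commute)
  have "\<exists>D. (F has_field_derivative D) (at l)" for l
  proof -
    define D where "D = l2_inner gauss_measure (dE l) cphi"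
    have "((\<lambda>z. (F z - F l) / (z - l)) \<longlongrightarrow> D) (at l)"
      unfolding tendsto_at_iff_sequentially
    proof (intro allI impI)
      fix Z assume Z: "\<forall>i. Z i \<in> UNIV - {l}" "Z \<longlonglongrightarrow> l"
      define q where "q n x = (gauss_exp w (Z n) x - gauss_exp w l x) / (Z n - l) - dE l x" for n x
      have "(\<lambda>n. (Z n - l) / (Z n - l)) \<longlonglongrightarrow> 1" using Z by simp
      from gauss_exp_diff_quotient[OF w Z(2) this]
      have lim: "(\<lambda>n. sq_int gauss_measure (q n)) \<longlonglongrightarrow> 0" by (simp add: q_def[abs_def] dE_def)
      have "dE l \<in> borel_measurable borel" unfolding dE_def[abs_def] by measurable
      then have dEl2: "dE l \<in> l2_space gauss_measure"
        by (rule l2_space_gauss_exp_bound) (unfold dE_def, rule norm_gauss_exp_deriv_le[OF w order_refl])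
      have ql2: "q n \<in> l2_space gauss_measure" for n
        using l2_space_diff[OF l2_space_mult_const[OF l2_space_diff[OF E[of "Z n"] E[of l]], of "1 / (Z n - l)"] dEl2]
        by (simp add: q_def[abs_def])
      have eq: "(F (Z n) - F l) / (Z n - l) - D = l2_inner gauss_measure (q n) cphi" for n
      proof -
        have "l2_inner gauss_measure (q n) cphi = l2_inner gauss_measure (\<lambda>x. 1 / (Z n - l) * (gauss_exp w (Z n) x - gauss_exp w l x) - dE l x) cphi"
          by (simp add: q_def[abs_def])
        also have "\<dots> = l2_inner gauss_measure (\<lambda>x. 1 / (Z n - l) * (gauss_exp w (Z n) x - gauss_exp w l x)) cphi - D"
          unfolding D_def by (intro l2_inner_diff_left l2_space_mult_const l2_space_diff E dEl2 cphi)
        also have "\<dots> = 1 / (Z n - l) * (F (Z n) - F l) - D"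
          unfolding l2_inner_mult_left F by (simp only: l2_inner_diff_left E cphi)
        finally show ?thesis by simp
      qed
      have "(\<lambda>n. l2_inner gauss_measure cphi (q n)) \<longlonglongrightarrow> 0"
        by (rule l2_inner_tendsto_0[where C = "sq_int gauss_measure cphi"]) (simp_all add: cphi ql2 lim sq_int_eq[OF cphi])
      then have "(\<lambda>n. cnj (l2_inner gauss_measure cphi (q n))) \<longlonglongrightarrow> cnj 0" by (rule tendsto_cnj)
      then have "(\<lambda>n. (F (Z n) - F l) / (Z n - l) - D) \<longlonglongrightarrow> 0"
        unfolding eq l2_inner_commute[of _ "q _"] by simp
      then show "((\<lambda>z. (F z - F l) / (z - l)) \<circ> Z) \<longlonglongrightarrow> D"
        by (simp add: o_def LIM_zero_cancel)
    qed
    then show ?thesis by (auto simp: has_field_derivative_iff)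
  qed
  then show ?thesis unfolding F_def[symmetric] holomorphic_on_def field_differentiable_def by (auto intro: has_field_derivative_at_within)
qed

section \<open>Vanishing of the exponential transform\<close>

text \<open>Separates a Gaussian exponent into a rotation-invariant part and the real part of a
  complex quadratic, the only part that a factor \<open>exp (- k * l\<^sup>2 / 2)\<close> can
  change.\<close>

lemma Re_power2_eq: "(Re z)\<^sup>2 = ((cmod z)\<^sup>2 + Re (z\<^sup>2)) / 2"
  by (simp add: cmod_power2 Re_power2)

lemma Im_power2_eq: "(Im z)\<^sup>2 = ((cmod z)\<^sup>2 - Re (z\<^sup>2)) / 2"
  by (simp add: cmod_power2 Re_power2)

text \<open>By \<open>Re_power2_eq\<close> the two exponents are half of
  \<open>\<alpha> * |l|^2 + Re (cA * l^2)\<close> and of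
  \<open>\<beta> * |l|^2 + Re (cB * l^2)\<close>. A factor \<open>exp (- k * l^2 / 2)\<close>
  subtracts \<open>k\<close> from both \<open>cA\<close> and \<open>cB\<close>. To reach pure
  squares of perpendicular coordinates, the differences must be \<alpha> and -\<beta> times one unit
  number \<open>u\<close>, which requires \<open>cmod (cA - cB) = \<alpha> + \<beta>\<close>. The
  square of the left side is \<open>(\<alpha> - \<beta>)^2 + 4 * (1 - \<alpha>) * (1 - \<beta>) *
  (sin s)^2\<close>, so this is what \<open>crit\<close> provides.\<close>

lemma hardy_entire_zero:
  fixes G :: "complex \<Rightarrow> complex" and J :: "real \<Rightarrow> real"
  assumes hol: "G holomorphic_on UNIV"
    and al: "0 < \<alpha>" "\<alpha> < 1" and be: "0 < \<beta>" "\<beta> < 1"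
    and crit: "(1 - \<alpha>) * (1 - \<beta>) * (sin s)\<^sup>2 = \<alpha> * \<beta>"
    and J: "\<And>r. J r \<le> C" "\<And>c. c \<noteq> 0 \<Longrightarrow> (\<lambda>n. J (real n * c)) \<longlonglongrightarrow> 0"
    and A: "\<And>l. cmod (G l) \<le> J (Re l) * exp (\<alpha> * (Re l)\<^sup>2 - Re (l\<^sup>2) / 2)"
    and B: "\<And>l. cmod (G l) \<le> C' * exp (\<beta> * (Re (cis s * l))\<^sup>2 - Re ((cis s * l)\<^sup>2) / 2)"
  shows "G l = 0"
proof -
  define cA where "cA = complex_of_real (\<alpha> - 1)"
  define cB where "cB = complex_of_real (\<beta> - 1) * (cis s)\<^sup>2"
  define u where "u = (cA - cB) / of_real (\<alpha> + \<beta>)"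
  \<comment> \<open>\<open>k\<close> is the point where the circles of radius \<open>\<alpha>\<close> around \<open>cA\<close> and of radius \<open>\<beta>\<close> around \<open>cB\<close> touch\<close>
  define k where "k = (of_real \<beta> * cA + of_real \<alpha> * cB) / of_real (\<alpha> + \<beta>)"
  \<comment> \<open>The rotation \<open>z = l * v\<close> turns \<open>u * l\<^sup>2\<close> into
    \<open>z\<^sup>2\<close>; since \<open>v\<close> has modulus 1, it is undone by
    \<open>cnj v\<close>.\<close>
  define v where "v = csqrt u"
  have rem: "Re (of_real c * z) = c * Re z" for c z by simp
  have ab: "complex_of_real (\<alpha> + \<beta>) \<noteq> 0" using al be by (simp only: of_real_eq_0_iff)
  have ku: "cA - k = of_real \<alpha> * u" "cB - k = - of_real \<beta> * u"
    using ab unfolding k_def u_def by (simp_all add: field_simps)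
  have v2: "v\<^sup>2 = u" by (simp add: v_def)
  have "(cmod (cA - cB))\<^sup>2 = (\<alpha> + \<beta>)\<^sup>2"
  proof -
    have re: "Re (cA - cB) = (\<alpha> - 1) - (\<beta> - 1) * (1 - 2 * (sin s)\<^sup>2)" and im: "Im (cA - cB) = - ((\<beta> - 1) * (2 * sin s * cos s))"
      by (simp_all add: cA_def cB_def Complex.DeMoivre cos_double_sin sin_double)
    have c2: "(cos s)\<^sup>2 = 1 - (sin s)\<^sup>2" by (rule cos_squared_eq)
    have "(cmod (cA - cB))\<^sup>2 = (\<alpha> - \<beta>)\<^sup>2 + 4 * ((1 - \<alpha>) * (1 - \<beta>) * (sin s)\<^sup>2)"
      unfolding cmod_power2 re im power2_minus power_mult_distrib c2 by (simp add: power2_eq_square algebra_simps)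
    then show ?thesis unfolding crit by (simp add: power2_eq_square algebra_simps)
  qed
  then have "cmod (cA - cB) = \<alpha> + \<beta>" using al be by (simp add: power2_eq_iff_nonneg)
  then have nu: "cmod u = 1" using al be by (simp add: u_def norm_divide flip: of_real_add)
  then have nv: "cmod v = 1" using v2 by (metis norm_power abs_norm_cancel power2_eq_1_iff abs_1 abs_minus_cancel)
  have vv: "v * cnj v = 1" using nv by (simp add: complex_norm_square[symmetric])
  \<comment> \<open>On the imaginary axis \<open>z = \<i> * n\<close> the bound for \<open>Q\<close>
    involves \<open>J\<close> at \<open>n * Im v\<close>, which must run to infinity for the decay
    of \<open>J\<close> to apply.\<close>
  have Imv: "Im v \<noteq> 0"
  proof
    assume "Im v = 0"
    then have "v = of_real (Re v)" by (simp add: complex_eq_iff)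
    with nv have "u = 1" using v2 by (metis norm_of_real of_real_1 of_real_power power2_abs power_one)
    then have "cA - cB = of_real (\<alpha> + \<beta>)" using ab by (simp add: u_def)
    then have "cB = cA - of_real (\<alpha> + \<beta>)" by (simp only: diff_eq_eq eq_diff_eq add.commute)
    then have "cB = of_real (- 1 - \<beta>)" by (simp add: cA_def)
    then have "cmod cB = 1 + \<beta>" using be by (simp only: norm_of_real)
    moreover have "cmod cB = 1 - \<beta>"
      unfolding cB_def norm_mult norm_power norm_of_real norm_cis using be by simp
    ultimately show False using be by simp
  qed
  define Q where "Q z = G (z * cnj v) * exp (of_real (- 1 / 2) * (k * (z * cnj v)\<^sup>2))" for z
  have Q_hol: "Q holomorphic_on UNIV"
    unfolding Q_def[abs_def]
    by (intro holomorphic_intros holomorphic_on_compose_gen[OF _ hol, unfolded o_def]) auto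
  have uz: "u * (z * cnj v)\<^sup>2 = z\<^sup>2" for z
  proof -
    have "u * (z * cnj v)\<^sup>2 = (v * cnj v)\<^sup>2 * z\<^sup>2" unfolding v2[symmetric] by (simp add: power_mult_distrib mult_ac)
    then show ?thesis by (simp add: vv)
  qed
  have QA: "cmod (Q z) \<le> J (Re (z * cnj v)) * exp (\<alpha> * (Re z)\<^sup>2)" for z
  proof -
    let ?l = "z * cnj v"
    have "cA * ?l\<^sup>2 - k * ?l\<^sup>2 = of_real \<alpha> * z\<^sup>2"
      unfolding left_diff_distrib[symmetric] ku mult.assoc uz ..
    then have "Re (cA * ?l\<^sup>2) - Re (k * ?l\<^sup>2) = \<alpha> * Re (z\<^sup>2)" by (metis rem minus_complex.simps(1))
    moreover have "Re (cA * ?l\<^sup>2) = (\<alpha> - 1) * Re (?l\<^sup>2)" unfolding cA_def by (simp only: rem)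
    moreover have "cmod ?l = cmod z" by (simp add: norm_mult nv)
    ultimately have eq: "\<alpha> * (Re ?l)\<^sup>2 - Re (?l\<^sup>2) / 2 - Re (k * ?l\<^sup>2) / 2 = \<alpha> * (Re z)\<^sup>2"
      unfolding Re_power2_eq[of ?l] Re_power2_eq[of z] by (simp add: field_simps)
    have "cmod (Q z) = cmod (G ?l) * exp (- Re (k * ?l\<^sup>2) / 2)"
    proof -
      have "- 1 / 2 * t = - t / 2" for t :: real by simp
      then show ?thesis unfolding Q_def norm_mult[of "G _"] norm_exp_eq_Re rem by (simp only:)
    qed
    also have "\<dots> \<le> (J (Re ?l) * exp (\<alpha> * (Re ?l)\<^sup>2 - Re (?l\<^sup>2) / 2)) * exp (- Re (k * ?l\<^sup>2) / 2)"
      by (intro mult_right_mono A) auto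
    also have "\<dots> = J (Re ?l) * exp (\<alpha> * (Re z)\<^sup>2)"
      unfolding mult.assoc exp_add[symmetric] eq[symmetric]
      by (simp only: diff_conv_add_uminus minus_divide_left add.assoc)
    finally show ?thesis .
  qed
  have QB: "cmod (Q z) \<le> C' * exp (\<beta> * (Im z)\<^sup>2)" for z
  proof -
    let ?l = "z * cnj v"
    have "cB * ?l\<^sup>2 - k * ?l\<^sup>2 = of_real (- \<beta>) * z\<^sup>2"
      unfolding left_diff_distrib[symmetric] ku mult.assoc uz by simp
    then have "Re (cB * ?l\<^sup>2) - Re (k * ?l\<^sup>2) = - \<beta> * Re (z\<^sup>2)" by (metis rem minus_complex.simps(1))
    moreover have "Re (cB * ?l\<^sup>2) = (\<beta> - 1) * Re ((cis s * ?l)\<^sup>2)"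
      unfolding cB_def power_mult_distrib[of "cis s"] mult.assoc by (simp only: rem)
    moreover have "cmod (cis s * ?l) = cmod z" by (simp add: norm_mult nv)
    ultimately have eq: "\<beta> * (Re (cis s * ?l))\<^sup>2 - Re ((cis s * ?l)\<^sup>2) / 2 - Re (k * ?l\<^sup>2) / 2 = \<beta> * (Im z)\<^sup>2"
      unfolding Re_power2_eq[of "cis s * ?l"] Im_power2_eq[of z] by (simp add: field_simps)
    have "cmod (Q z) = cmod (G ?l) * exp (- Re (k * ?l\<^sup>2) / 2)"
    proof -
      have "- 1 / 2 * t = - t / 2" for t :: real by simp
      then show ?thesis unfolding Q_def norm_mult[of "G _"] norm_exp_eq_Re rem by (simp only:)
    qed
    also have "\<dots> \<le> (C' * exp (\<beta> * (Re (cis s * ?l))\<^sup>2 - Re ((cis s * ?l)\<^sup>2) / 2)) * exp (- Re (k * ?l\<^sup>2) / 2)"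
      by (intro mult_right_mono B) auto
    also have "\<dots> = C' * exp (\<beta> * (Im z)\<^sup>2)"
      unfolding mult.assoc exp_add[symmetric] eq[symmetric]
      by (simp only: diff_conv_add_uminus minus_divide_left add.assoc)
    finally show ?thesis .
  qed
  define D where "D = max 1 (max C C')"
  have Q_const: "Q z = Q 0" for z
  proof (rule entire_bounded_cross_constant[OF Q_hol, of D \<alpha> \<beta>])
    show "cmod (Q z) \<le> D * exp (\<alpha> * (Re z)\<^sup>2)" for z
      using J(1) by (intro order_trans[OF QA] mult_right_mono) (auto simp: D_def le_max_iff_disj)
    show "cmod (Q z) \<le> D * exp (\<beta> * (Im z)\<^sup>2)" for z
      by (intro order_trans[OF QB] mult_right_mono) (auto simp: D_def)
  qed (use al be in \<open>auto simp: D_def\<close>)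
  \<comment> \<open>The Gaussian factor in \<open>QA\<close> equals 1 on the imaginary axis, so only
    \<open>J\<close> remains.\<close>
  have "cmod (Q 0) \<le> J (real n * Im v)" for n
    using QA[of "\<i> * of_nat n"] Q_const[of "\<i> * of_nat n"] by simp
  then have "cmod (Q 0) \<le> 0"
    by (intro LIMSEQ_le_const[OF J(2)[OF Imv]]) auto
  then have "Q (l * v) = 0" using Q_const[of "l * v"] by simp
  moreover have "l * v * cnj v = l" using vv by (simp add: mult.assoc)
  ultimately show ?thesis by (simp add: Q_def)
qed

text \<open>Half of the Gaussian weight centred at \<open>2 * \<alpha> * Re l\<close> is kept with each factor in the
  Cauchy-Schwarz inequality; as the centre moves to infinity, the factor containing \<open>\<phi>\<close> tends to 0.\<close>

lemma gaussian_transform_bound: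
  fixes w :: "real ^ 'm::finite"
  assumes a: "a > 0" and w: "norm w = 1" and phi: "\<phi> \<in> l2_space gauss_measure"
    and psi: "(\<lambda>x. complex_of_real (exp (a * (norm x)\<^sup>2)) * \<phi> x) \<in> l2_space gauss_measure"
  obtains J C where "\<And>r. J r \<le> C" "\<And>c. c \<noteq> 0 \<Longrightarrow> (\<lambda>n. J (real n * c)) \<longlonglongrightarrow> 0"
    "\<And>l. cmod (\<integral>x. \<phi> x * gauss_exp w l x \<partial>gauss_measure)
       \<le> J (Re l) * exp (1 / (4 * a + 1) * (Re l)\<^sup>2 - Re (l\<^sup>2) / 2)"
proof -
  define \<alpha> where "\<alpha> = 1 / (4 * a + 1)"
  \<comment> \<open>A factor \<open>exp (- (norm x)\<^sup>2 / 4)\<close> is reserved for \<psi>,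
    since its square restores the Gaussian measure. The remaining exponent has quadratic coefficient
    \<open>a + 1 / 4\<close>, and completing its square puts the centre at
    \<open>Re l / (2 * p) = 2 * \<alpha> * Re l\<close> and leaves
    \<open>\<alpha> * (Re l)\<^sup>2\<close>.\<close>
  define p where "p = a + 1 / 4"
  have alp: "\<alpha> > 0" "p > 0" "4 * p * \<alpha> = 1" using a by (auto simp: \<alpha>_def p_def field_simps)
  define K where "K = (2 * pi) powr (- (real CARD('m) / 2))"
  have K: "K > 0" by (simp add: K_def)
  define \<psi> where "\<psi> x = exp (a * (norm x)\<^sup>2) * cmod (\<phi> x)" for x
  have phim [measurable]: "\<phi> \<in> borel_measurable borel" using l2_space_measurable[OF phi] by simp
  have psim [measurable]: "\<psi> \<in> borel_measurable borel" unfolding \<psi>_def[abs_def] by measurable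
  have psi2: "integrable gauss_measure (\<lambda>x. (\<psi> x)\<^sup>2)"
    using psi by (simp add: l2_space_iff norm_mult \<psi>_def)
  define g where "g r x = exp (- p * (norm (x - (2 * \<alpha> * r) *\<^sub>R w))\<^sup>2)" for r x
  have gm [measurable]: "g r \<in> borel_measurable borel" for r unfolding g_def[abs_def] by measurable
  have g: "0 \<le> g r x" "g r x \<le> 1" for r x using alp by (auto simp: g_def)
  define c0 where "c0 = integral\<^sup>L lborel (\<lambda>x::real ^ 'm. exp (- p * (norm x)\<^sup>2))"
  have c0: "c0 \<ge> 0" by (simp add: c0_def)
  have c0eq: "(\<integral>\<^sup>+x. ennreal (g r x) \<partial>lborel) = ennreal c0" for r
  proof -
    have "(\<integral>\<^sup>+x. ennreal (g r x) \<partial>lborel) = (\<integral>\<^sup>+x. ennreal (g r x) \<partial>distr lborel borel ((+) ((2 * \<alpha> * r) *\<^sub>R w)))"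
      by (simp add: lborel_distr_plus)
    also have "\<dots> = nn_integral lborel (\<lambda>x::real ^ 'm. ennreal (exp (- p * (norm x)\<^sup>2)))"
      by (subst nn_integral_distr) (auto simp: g_def)
    also have "\<dots> = ennreal c0" unfolding c0_def
      by (intro nn_integral_eq_integral integrable_exp_neg_norm_sq alp) auto
    finally show ?thesis .
  qed
  define I where "I r = (\<integral>x. (\<psi> x)\<^sup>2 * g r x \<partial>gauss_measure)" for r
  have Iint: "integrable gauss_measure (\<lambda>x. (\<psi> x)\<^sup>2 * g r x)" for r
    by (rule Bochner_Integration.integrable_bound[OF psi2]) (use g in \<open>auto simp: abs_mult mult_left_le\<close>)
  have I: "0 \<le> I r" "I r \<le> (\<integral>x. (\<psi> x)\<^sup>2 \<partial>gauss_measure)" for r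
    unfolding I_def using g by (auto intro!: integral_mono Iint psi2 simp: mult_left_le)
  define J where "J r = sqrt (K * c0 * I r)" for r
  show ?thesis
  proof (rule that[of J])
    show "J r \<le> sqrt (K * c0 * (\<integral>x. (\<psi> x)\<^sup>2 \<partial>gauss_measure))" for r
      unfolding J_def using I K c0 by (intro real_sqrt_le_mono mult_left_mono) auto
  next
    fix c :: real assume c: "c \<noteq> 0"
    have "(\<lambda>n. I (real n * c)) \<longlonglongrightarrow> integral\<^sup>L gauss_measure (\<lambda>x::real ^ 'm. 0)"
      unfolding I_def
    proof (rule integral_dominated_convergence[OF _ _ psi2])
      show "AE x in gauss_measure. norm ((\<psi> x)\<^sup>2 * g (real n * c) x) \<le> (\<psi> x)\<^sup>2" for n
        using g by (auto simp: abs_mult mult_left_le)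
      show "AE x in gauss_measure. (\<lambda>n. (\<psi> x)\<^sup>2 * g (real n * c) x) \<longlonglongrightarrow> 0"
      proof (rule AE_I2)
        fix x
        have le: "2 * \<alpha> * \<bar>c\<bar> * real n - norm x \<le> norm (x - (2 * \<alpha> * (real n * c)) *\<^sub>R w)" for n
          using norm_triangle_ineq2[of "(2 * \<alpha> * (real n * c)) *\<^sub>R w" x] alp w
          by (simp add: abs_mult norm_minus_commute mult_ac)
        have "filterlim (\<lambda>n. 2 * \<alpha> * \<bar>c\<bar> * real n - norm x) at_top sequentially"
          using alp c by real_asymp
        then have "filterlim (\<lambda>n. norm (x - (2 * \<alpha> * (real n * c)) *\<^sub>R w)) at_top sequentially"
          by (rule filterlim_at_top_mono) (use le in auto)
        then have "filterlim (\<lambda>n. - p * (norm (x - (2 * \<alpha> * (real n * c)) *\<^sub>R w))\<^sup>2) at_bot sequentially"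
          using alp by (intro filterlim_tendsto_neg_mult_at_bot[OF tendsto_const] filterlim_pow_at_top) auto
        then have "(\<lambda>n. g (real n * c) x) \<longlonglongrightarrow> 0"
          unfolding g_def by (rule filterlim_compose[OF exp_at_bot])
        then show "(\<lambda>n. (\<psi> x)\<^sup>2 * g (real n * c) x) \<longlonglongrightarrow> 0" by (rule tendsto_mult_right_zero)
      qed
    qed auto
    then have "(\<lambda>n. sqrt (K * c0 * I (real n * c))) \<longlonglongrightarrow> sqrt (K * c0 * 0)"
      by (intro tendsto_intros) simp
    then show "(\<lambda>n. J (real n * c)) \<longlonglongrightarrow> 0" by (simp add: J_def)
  next
    fix l
    define r where "r = Re l"
    define q where "q x = p * (norm (x - (2 * \<alpha> * r) *\<^sub>R w))\<^sup>2" for x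
    define e where "e = \<alpha> * r\<^sup>2 - Re (l\<^sup>2) / 2"
    define u where "u x = \<psi> x * exp (- ((norm x)\<^sup>2 / 4)) * exp (- q x / 2)" for x
    define h where "h x = exp (- q x / 2)" for x
    have qeq: "q x = a * (norm x)\<^sup>2 + (norm x)\<^sup>2 / 4 - r * (w \<bullet> x) + \<alpha> * r\<^sup>2" for x
    proof -
      have "q x = p * (norm x)\<^sup>2 - (4 * p * \<alpha>) * r * (w \<bullet> x) + (4 * p * \<alpha>) * \<alpha> * r\<^sup>2 * (norm w)\<^sup>2"
        unfolding q_def power2_norm_eq_inner
        by (simp add: inner_diff inner_commute algebra_simps power2_eq_square)
      then show ?thesis unfolding alp(3) w by (simp add: p_def algebra_simps)
    qed
    have [measurable]: "u \<in> borel_measurable borel" "h \<in> borel_measurable borel"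
      unfolding u_def[abs_def] h_def[abs_def] q_def by measurable
    have int: "integrable gauss_measure (\<lambda>x. \<phi> x * gauss_exp w l x)"
    proof -
      have "cnj (gauss_exp w (cnj l) x) = gauss_exp w l x" for x by (simp add: gauss_exp_def exp_cnj)
      then show ?thesis using l2_inner_integrable[OF phi gauss_exp_l2[OF w, of "cnj l"]] by simp
    qed
    have pt: "gauss_density x * cmod (\<phi> x * gauss_exp w l x) = K * exp e * (u x * h x)" for x
    proof -
      have "gauss_density x * cmod (\<phi> x * gauss_exp w l x) =
         K * cmod (\<phi> x) * exp (- ((norm x)\<^sup>2 / 2) + (r * (w \<bullet> x) - Re (l\<^sup>2) / 2))"
        unfolding exp_add gauss_density_def K_def norm_mult norm_gauss_exp r_def by (simp only: mult_ac)
      also have "- ((norm x)\<^sup>2 / 2) + (r * (w \<bullet> x) - Re (l\<^sup>2) / 2)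
          = e + (a * (norm x)\<^sup>2 + (- ((norm x)\<^sup>2 / 4) + (- q x / 2 + - q x / 2)))"
        by (simp add: qeq e_def field_simps)
      also have "K * cmod (\<phi> x) * exp (e + (a * (norm x)\<^sup>2 + (- ((norm x)\<^sup>2 / 4) + (- q x / 2 + - q x / 2))))
          = K * exp e * (u x * h x)"
        unfolding exp_add u_def h_def \<psi>_def by (simp only: mult_ac)
      finally show ?thesis .
    qed
    have u0: "u x \<ge> 0" "h x \<ge> 0" for x by (auto simp: u_def h_def \<psi>_def)
    have "ennreal (cmod (\<integral>x. \<phi> x * gauss_exp w l x \<partial>gauss_measure)) \<le> (\<integral>\<^sup>+x. ennreal (cmod (\<phi> x * gauss_exp w l x)) \<partial>gauss_measure)"
      by (rule integral_norm_bound_ennreal[OF int])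
    also have "\<dots> = (\<integral>\<^sup>+x. ennreal (K * exp e * (u x * h x)) \<partial>lborel)"
      unfolding gauss_measure_eq
      by (subst nn_integral_density) (auto simp: pt less_imp_le[OF gauss_density_pos] simp flip: ennreal_mult)
    also have "\<dots> = ennreal (K * exp e) * (\<integral>\<^sup>+x. ennreal (u x) * ennreal (h x) \<partial>lborel)"
      using K u0 by (simp add: ennreal_mult nn_integral_cmult)
    finally have "(ennreal (cmod (\<integral>x. \<phi> x * gauss_exp w l x \<partial>gauss_measure)))\<^sup>2
       \<le> (ennreal (K * exp e))\<^sup>2 * (\<integral>\<^sup>+x. ennreal (u x) * ennreal (h x) \<partial>lborel)\<^sup>2"
      unfolding power_mult_distrib[symmetric] by (rule power_mono) simp
    also have "\<dots> \<le> (ennreal (K * exp e))\<^sup>2 * ((\<integral>\<^sup>+x. (ennreal (u x))\<^sup>2 \<partial>lborel) * (\<integral>\<^sup>+x. (ennreal (h x))\<^sup>2 \<partial>lborel))"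
      by (intro mult_left_mono Cauchy_Schwarz_nn_integral) auto
    also have "(\<integral>\<^sup>+x. (ennreal (h x))\<^sup>2 \<partial>lborel) = ennreal c0"
    proof -
      have "(ennreal (h x))\<^sup>2 = ennreal (g r x)" for x
      proof -
        have "(h x)\<^sup>2 = g r x" unfolding h_def exp_double[symmetric] g_def q_def by simp
        then show ?thesis using u0 by (simp add: ennreal_power)
      qed
      then show ?thesis by (simp add: c0eq)
    qed
    also have "(\<integral>\<^sup>+x. (ennreal (u x))\<^sup>2 \<partial>lborel) = ennreal (I r / K)"
    proof -
      have "(ennreal (u x))\<^sup>2 = ennreal (1 / K) * ennreal (gauss_density x) * ennreal ((\<psi> x)\<^sup>2 * g r x)" for x
      proof -
        have "(u x)\<^sup>2 = (\<psi> x)\<^sup>2 * (exp (- ((norm x)\<^sup>2 / 2)) * g r x)"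
          unfolding u_def power_mult_distrib exp_double[symmetric] g_def q_def by simp
        then show ?thesis using K u0 g
          by (simp add: ennreal_power gauss_density_def K_def[symmetric] flip: ennreal_mult)
      qed
      then have "(\<integral>\<^sup>+x. (ennreal (u x))\<^sup>2 \<partial>lborel) = ennreal (1 / K) * (\<integral>\<^sup>+x. ennreal (gauss_density x) * ennreal ((\<psi> x)\<^sup>2 * g r x) \<partial>lborel)"
        by (simp add: mult.assoc nn_integral_cmult)
      also have "(\<integral>\<^sup>+x. ennreal (gauss_density x) * ennreal ((\<psi> x)\<^sup>2 * g r x) \<partial>lborel) = (\<integral>\<^sup>+x. ennreal ((\<psi> x)\<^sup>2 * g r x) \<partial>gauss_measure)"
        unfolding gauss_measure_eq by (subst nn_integral_density) auto
      also have "\<dots> = ennreal (I r)"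
        unfolding I_def using g by (intro nn_integral_eq_integral Iint) auto
      finally show ?thesis using K I by (simp flip: ennreal_mult)
    qed
    also have "(ennreal (K * exp e))\<^sup>2 * (ennreal (I r / K) * ennreal c0) = ennreal ((K * exp e)\<^sup>2 * (I r / K * c0))"
      using K I c0 by (simp add: ennreal_power flip: ennreal_mult)
    also have "(K * exp e)\<^sup>2 * (I r / K * c0) = (J r * exp e)\<^sup>2"
      using K I c0 by (simp add: J_def power_mult_distrib power2_eq_square field_simps)
    finally have "(cmod (\<integral>x. \<phi> x * gauss_exp w l x \<partial>gauss_measure))\<^sup>2 \<le> (J r * exp e)\<^sup>2"
      by (simp add: ennreal_power)
    then have "cmod (\<integral>x. \<phi> x * gauss_exp w l x \<partial>gauss_measure) \<le> J r * exp e"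
      by (rule power2_le_imp_le) (use K I c0 in \<open>simp add: J_def\<close>)
    then show "cmod (\<integral>x. \<phi> x * gauss_exp w l x \<partial>gauss_measure) \<le> J (Re l) * exp (1 / (4 * a + 1) * (Re l)\<^sup>2 - Re (l\<^sup>2) / 2)"
      by (simp add: r_def e_def \<alpha>_def)
  qed
qed

section \<open>Injectivity of the Fourier transform\<close>

lemma prob_space_gauss_measure: "prob_space (gauss_measure :: (real ^ 'm::finite) measure)"
proof (rule prob_spaceI)
  let ?G = "gauss_measure :: (real ^ 'm) measure"
  have int: "integrable ?G (\<lambda>x. 1::real)"
    using integrable_gauss_exp_norm[of 0, where 'm = 'm] by simp
  have "complex_of_real (\<integral>x. 1 \<partial>?G) = 1"
    using char_gauss_measure[of "0 :: real ^ 'm"] unfolding integral_complex_of_real[symmetric] by simp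
  then have "(\<integral>x. 1 \<partial>?G) = (1::real)" by (simp only: of_real_eq_1_iff)
  moreover have "emeasure ?G (space ?G) = (\<integral>\<^sup>+x. ennreal 1 \<partial>?G)" by simp
  ultimately show "emeasure ?G (space ?G) = 1" using nn_integral_eq_integral[OF int] by simp
qed

text \<open>The kernel is itself the characteristic function of \<open>gauss_measure\<close>. By
  Fubini the convolution is an average of the Fourier integrals of \<phi>, all of which
  vanish.\<close>

lemma gaussian_convolution_zero:
  fixes \<phi> :: "real ^ 'm::finite \<Rightarrow> complex"
  assumes int: "integrable lborel \<phi>" and e: "e > 0"
    and four: "\<And>\<eta>. (\<integral>x. \<phi> x * exp (\<i> * of_real (\<eta> \<bullet> x)) \<partial>lborel) = 0"
  shows "(\<integral>x. \<phi> x * of_real (exp (- ((norm ((1 / e) *\<^sub>R (y - x)))\<^sup>2 / 2))) \<partial>lborel) = 0"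
proof -
  interpret G: prob_space "gauss_measure :: (real ^ 'm) measure" by (rule prob_space_gauss_measure)
  interpret P: pair_sigma_finite "lborel :: (real ^ 'm) measure" "gauss_measure :: (real ^ 'm) measure" ..
  have [measurable]: "\<phi> \<in> borel_measurable borel" using borel_measurable_integrable[OF int] by simp
  define F where "F x \<eta> = \<phi> x * exp (\<i> * of_real (((1 / e) *\<^sub>R (y - x)) \<bullet> \<eta>))" for x \<eta>
  have nF: "norm (F x \<eta>) = norm (\<phi> x)" for x \<eta> by (simp add: F_def norm_mult)
  have Fm: "case_prod F \<in> borel_measurable (lborel \<Otimes>\<^sub>M gauss_measure)"
    unfolding F_def[abs_def] by measurable
  have "integrable (lborel \<Otimes>\<^sub>M gauss_measure) (case_prod F)"
  proof (rule P.Fubini_integrable[OF Fm])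
    show "integrable lborel (\<lambda>x. \<integral>\<eta>. norm (case (x, \<eta>) of (x, \<eta>) \<Rightarrow> F x \<eta>) \<partial>gauss_measure)"
      using int by (simp add: nF G.prob_space[simplified])
    show "AE x in lborel. integrable gauss_measure (\<lambda>\<eta>. case (x, \<eta>) of (x, \<eta>) \<Rightarrow> F x \<eta>)"
    proof (rule AE_I2)
      fix x
      have "F x \<in> borel_measurable gauss_measure" unfolding F_def[abs_def] by measurable
      then show "integrable gauss_measure (\<lambda>\<eta>. case (x, \<eta>) of (x, \<eta>) \<Rightarrow> F x \<eta>)"
        by (intro G.integrable_const_bound[where B = "norm (\<phi> x)"]) (auto simp: nF)
    qed
  qed
  from P.Fubini_integral[OF this]
  have "(\<integral>x. (\<integral>\<eta>. F x \<eta> \<partial>gauss_measure) \<partial>lborel) = (\<integral>\<eta>. (\<integral>x. F x \<eta> \<partial>lborel) \<partial>gauss_measure)" by simp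
  also have "(\<integral>x. F x \<eta> \<partial>lborel) = 0" for \<eta>
  proof -
    have *: "F x \<eta> = exp (\<i> * of_real (((1 / e) *\<^sub>R y) \<bullet> \<eta>)) * (\<phi> x * exp (\<i> * of_real ((- (1 / e) *\<^sub>R \<eta>) \<bullet> x)))" for x
    proof -
      have "((1 / e) *\<^sub>R (y - x)) \<bullet> \<eta> = ((1 / e) *\<^sub>R y) \<bullet> \<eta> + (- (1 / e) *\<^sub>R \<eta>) \<bullet> x"
        by (simp add: inner_diff_left inner_diff_right inner_commute diff_divide_distrib)
      then show ?thesis unfolding F_def by (simp only: of_real_add distrib_left exp_add mult_ac)
    qed
    show ?thesis unfolding * integral_mult_right_zero four by simp
  qed
  then have "(\<integral>\<eta>. (\<integral>x. F x \<eta> \<partial>lborel) \<partial>gauss_measure) = 0" by simp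
  also have "(\<integral>x. (\<integral>\<eta>. F x \<eta> \<partial>gauss_measure) \<partial>lborel) =
      (\<integral>x. \<phi> x * of_real (exp (- ((norm ((1 / e) *\<^sub>R (y - x)))\<^sup>2 / 2))) \<partial>lborel)"
    unfolding F_def integral_mult_right_zero char_gauss_measure ..
  finally show ?thesis .
qed

text \<open>Averaging the indicator over Gaussian noise of size \<open>e\<close> is, up to a
  constant, integration of the kernel of \<open>gaussian_convolution_zero\<close> over
  \<open>y\<close> in \<open>B\<close>. Finite measure of \<open>B\<close> makes Fubini
  applicable.\<close>

lemma mollified_indicator_zero:
  fixes \<phi> :: "real ^ 'm::finite \<Rightarrow> complex"
  assumes int: "integrable lborel \<phi>" and e: "e > 0"
    and B [measurable]: "B \<in> sets borel" and Bfin: "emeasure lborel B < \<infinity>"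
    and four: "\<And>\<eta>. (\<integral>x. \<phi> x * exp (\<i> * of_real (\<eta> \<bullet> x)) \<partial>lborel) = 0"
  shows "(\<integral>x. \<phi> x * of_real (\<integral>u. indicat_real B (x + e *\<^sub>R u) \<partial>gauss_measure) \<partial>lborel) = 0"
proof -
  have [measurable]: "\<phi> \<in> borel_measurable borel" using borel_measurable_integrable[OF int] by simp
  define g where "g z = exp (- ((norm ((1 / e) *\<^sub>R z))\<^sup>2 / 2))" for z :: "real ^ 'm"
  have g: "0 \<le> g z" "g z \<le> 1" for z by (auto simp: g_def)
  have gm [measurable]: "g \<in> borel_measurable borel" unfolding g_def[abs_def] by measurable
  define K where "K = (2 * pi) powr (- (real CARD('m) / 2))"
  \<comment> \<open>Substitution \<open>y = x + e *\<^sub>R u\<close>.\<close>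
  have cv: "e ^ CARD('m) * (\<integral>u. indicat_real B (x + e *\<^sub>R u) \<partial>gauss_measure) = K * (\<integral>y. indicat_real B y * g (y - x) \<partial>lborel)" for x
  proof -
    have "(\<integral>y. indicat_real B y * g (y - x) \<partial>lborel)
      = (\<integral>y. indicat_real B y * g (y - x) \<partial>density (distr lborel borel (\<lambda>u. x + e *\<^sub>R u)) (\<lambda>_. \<bar>e\<bar> ^ DIM(real ^ 'm)))"
      using lborel_affine[of e x] e by simp
    also have "\<dots> = (\<integral>u. \<bar>e\<bar> ^ DIM(real ^ 'm) * (indicat_real B (x + e *\<^sub>R u) * g (e *\<^sub>R u)) \<partial>lborel)"
      using e by (simp add: integral_density integral_distr)
    finally have "K * (\<integral>y. indicat_real B y * g (y - x) \<partial>lborel) =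
       e ^ CARD('m) * (\<integral>u. K * (indicat_real B (x + e *\<^sub>R u) * g (e *\<^sub>R u)) \<partial>lborel)"
      using e by simp
    also have "(\<integral>u. K * (indicat_real B (x + e *\<^sub>R u) * g (e *\<^sub>R u)) \<partial>lborel) = (\<integral>u. gauss_density u *\<^sub>R indicat_real B (x + e *\<^sub>R u) \<partial>lborel)"
      using e by (intro Bochner_Integration.integral_cong) (simp_all add: gauss_density_def g_def K_def mult_ac)
    also have "\<dots> = (\<integral>u. indicat_real B (x + e *\<^sub>R u) \<partial>gauss_measure)"
      by (rule integral_gauss[symmetric]) measurable
    finally show ?thesis ..
  qed
  define F where "F x y = \<phi> x * of_real (indicat_real B y * g (y - x))" for x y
  have Fm: "case_prod F \<in> borel_measurable (lborel \<Otimes>\<^sub>M lborel)"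
    unfolding F_def[abs_def] by measurable
  have B_int: "integrable lborel (indicat_real B)" using Bfin by (intro integrable_real_indicator) auto
  have iB: "integrable lborel (\<lambda>y. indicat_real B y * g (y - x))" for x
    by (rule Bochner_Integration.integrable_bound[OF B_int]) (use g in \<open>auto simp: abs_mult indicator_def\<close>)
  have le: "(\<integral>y. indicat_real B y * g (y - x) \<partial>lborel) \<le> measure lborel B" for x
  proof -
    have "(\<integral>y. indicat_real B y * g (y - x) \<partial>lborel) \<le> (\<integral>y. indicat_real B y \<partial>lborel)"
      by (rule integral_mono[OF iB B_int]) (use g in \<open>auto simp: indicator_def\<close>)
    then show ?thesis using Bfin by simp
  qed
  have ge: "0 \<le> (\<integral>y. indicat_real B y * g (y - x) \<partial>lborel)" for x
    using g by (auto intro!: Bochner_Integration.integral_nonneg)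
  have "integrable (lborel \<Otimes>\<^sub>M lborel) (case_prod F)"
  proof (rule lborel_pair.Fubini_integrable[OF Fm])
    have "integrable lborel (\<lambda>x. norm (\<phi> x) * (\<integral>y. indicat_real B y * g (y - x) \<partial>lborel))"
    proof (rule Bochner_Integration.integrable_bound)
      show "integrable lborel (\<lambda>x. measure lborel B * norm (\<phi> x))" using int by simp
      show "AE x in lborel. norm (norm (\<phi> x) * (\<integral>y. indicat_real B y * g (y - x) \<partial>lborel)) \<le> norm (measure lborel B * norm (\<phi> x))"
        using le ge by (auto simp: abs_mult mult.commute[of "norm _"] intro!: mult_right_mono)
    qed measurable
    moreover have "(\<integral>y. norm (F x y) \<partial>lborel) = norm (\<phi> x) * (\<integral>y. indicat_real B y * g (y - x) \<partial>lborel)" for x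
      using g by (simp add: F_def norm_mult abs_mult)
    ultimately show "integrable lborel (\<lambda>x. \<integral>y. norm (case (x, y) of (x, y) \<Rightarrow> F x y) \<partial>lborel)" by simp
    show "AE x in lborel. integrable lborel (\<lambda>y. case (x, y) of (x, y) \<Rightarrow> F x y)"
      unfolding F_def using iB by (auto simp del: of_real_mult)
  qed
  from lborel_pair.Fubini_integral[OF this]
  have "(\<integral>x. (\<integral>y. F x y \<partial>lborel) \<partial>lborel) = (\<integral>y. (\<integral>x. F x y \<partial>lborel) \<partial>lborel)" by simp
  also have "(\<integral>x. F x y \<partial>lborel) = 0" for y
  proof -
    have "(\<integral>x. F x y \<partial>lborel) = of_real (indicat_real B y) * (\<integral>x. \<phi> x * of_real (g (y - x)) \<partial>lborel)"
      unfolding F_def of_real_mult mult.left_commute[of "\<phi> _"] integral_mult_right_zero ..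
    then show ?thesis using gaussian_convolution_zero[OF int e four] by (simp add: g_def)
  qed
  then have "(\<integral>y. (\<integral>x. F x y \<partial>lborel) \<partial>lborel) = 0" by simp
  finally have "(\<integral>x. \<phi> x * of_real (\<integral>y. indicat_real B y * g (y - x) \<partial>lborel) \<partial>lborel) = 0"
    by (simp add: F_def del: of_real_mult)
  then have "of_real K * (\<integral>x. \<phi> x * of_real (\<integral>y. indicat_real B y * g (y - x) \<partial>lborel) \<partial>lborel) = 0" by simp
  also have "of_real K * (\<integral>x. \<phi> x * of_real (\<integral>y. indicat_real B y * g (y - x) \<partial>lborel) \<partial>lborel)
     = (\<integral>x. \<phi> x * of_real (K * (\<integral>y. indicat_real B y * g (y - x) \<partial>lborel)) \<partial>lborel)"
    unfolding of_real_mult mult.left_commute[of "\<phi> _"] integral_mult_right_zero ..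
  also have "\<dots> = of_real (e ^ CARD('m)) * (\<integral>x. \<phi> x * of_real (\<integral>u. indicat_real B (x + e *\<^sub>R u) \<partial>gauss_measure) \<partial>lborel)"
    unfolding cv[symmetric] of_real_mult mult.left_commute[of "\<phi> _"] integral_mult_right_zero ..
  finally show ?thesis using e by simp
qed

text \<open>As the noise shrinks, the mollified indicators converge to the indicator off the
  boundary of the box, which is a null set.\<close>

lemma integral_box_zero:
  fixes \<phi> :: "real ^ 'm::finite \<Rightarrow> complex"
  assumes int: "integrable lborel \<phi>"
    and four: "\<And>\<eta>. (\<integral>x. \<phi> x * exp (\<i> * of_real (\<eta> \<bullet> x)) \<partial>lborel) = 0"
  shows "(\<integral>x. \<phi> x * of_real (indicat_real (box a b) x) \<partial>lborel) = 0"
proof -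
  interpret G: prob_space "gauss_measure :: (real ^ 'm) measure" by (rule prob_space_gauss_measure)
  have [measurable]: "\<phi> \<in> borel_measurable borel" using borel_measurable_integrable[OF int] by simp
  define r where "r n = 1 / real (Suc n)" for n
  have r: "0 < r n" for n by (auto simp: r_def)
  have r0: "r \<longlonglongrightarrow> 0" unfolding r_def[abs_def] by (rule LIMSEQ_Suc[OF lim_inverse_n'])
  define v where "v n x = (\<integral>u. indicat_real (box a b) (x + r n *\<^sub>R u) \<partial>gauss_measure)" for n x
  have vm [measurable]: "v n \<in> borel_measurable borel" for n
    unfolding v_def[abs_def] by measurable
  have v1: "\<bar>v n x\<bar> \<le> 1" for n x
  proof -
    have "v n x = G.prob ((\<lambda>u. x + r n *\<^sub>R u) -` box a b)"
    proof -
      have "v n x = (\<integral>u. indicat_real ((\<lambda>u. x + r n *\<^sub>R u) -` box a b) u \<partial>gauss_measure)"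
        unfolding v_def by (intro Bochner_Integration.integral_cong) (auto simp: indicator_def)
      then show ?thesis by simp
    qed
    then show ?thesis by simp
  qed
  have lim_in: "(\<lambda>n. x + r n *\<^sub>R u) \<longlonglongrightarrow> x" for x u :: "real ^ 'm"
    using tendsto_add[OF tendsto_const[of x] tendsto_scaleR[OF r0 tendsto_const[of u]]] by simp
  have vlim: "(\<lambda>n. v n x) \<longlonglongrightarrow> indicat_real (box a b) x" if x: "x \<notin> cbox a b - box a b" for x
  proof -
    have "(\<lambda>n. v n x) \<longlonglongrightarrow> (\<integral>u. indicat_real (box a b) x \<partial>(gauss_measure :: (real ^ 'm) measure))"
      unfolding v_def
    proof (rule integral_dominated_convergence[where w = "\<lambda>_. 1"])
      show "AE u in gauss_measure. (\<lambda>n. indicat_real (box a b) (x + r n *\<^sub>R u)) \<longlonglongrightarrow> indicat_real (box a b) x"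
      proof (rule AE_I2)
        fix u
        have "eventually (\<lambda>n. indicat_real (box a b) (x + r n *\<^sub>R u) = indicat_real (box a b) x) sequentially"
        proof (cases "x \<in> box a b")
          case True
          have "eventually (\<lambda>n. x + r n *\<^sub>R u \<in> box a b) sequentially"
            by (rule topological_tendstoD[OF lim_in open_box True])
          then show ?thesis by eventually_elim (simp add: True)
        next
          case False
          then have "x \<in> - cbox a b" using x by simp
          then have "eventually (\<lambda>n. x + r n *\<^sub>R u \<in> - cbox a b) sequentially"
            by (intro topological_tendstoD[OF lim_in]) auto
          then show ?thesis
            by eventually_elim (use False box_subset_cbox[of a b] in \<open>auto simp: indicator_def\<close>)
        qed
        then show "(\<lambda>n. indicat_real (box a b) (x + r n *\<^sub>R u)) \<longlonglongrightarrow> indicat_real (box a b) x"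
          by (rule tendsto_eventually)
      qed
    qed (auto simp: indicator_def)
    then show ?thesis using G.prob_space by simp
  qed
  have ae: "AE x in lborel. x \<notin> cbox a b - box a b"
    by (rule AE_not_in) (auto simp: null_sets_def emeasure_Diff emeasure_lborel_cbox_eq emeasure_lborel_box_eq box_subset_cbox)
  have "(\<lambda>n. \<integral>x. \<phi> x * of_real (v n x) \<partial>lborel) \<longlonglongrightarrow> (\<integral>x. \<phi> x * of_real (indicat_real (box a b) x) \<partial>lborel)"
  proof (rule integral_dominated_convergence[where w = "\<lambda>x. norm (\<phi> x)"])
    show "AE x in lborel. (\<lambda>n. \<phi> x * of_real (v n x)) \<longlonglongrightarrow> \<phi> x * of_real (indicat_real (box a b) x)"
      using ae by eventually_elim (intro tendsto_intros vlim)
    show "AE x in lborel. norm (\<phi> x * of_real (v n x)) \<le> norm (\<phi> x)" for n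
      using v1 by (auto simp: norm_mult mult_left_le)
  qed (use int in auto)
  moreover have "(\<integral>x. \<phi> x * of_real (v n x) \<partial>lborel) = 0" for n
    unfolding v_def by (rule mollified_indicator_zero[OF int r _ _ four]) (auto simp: emeasure_lborel_box_eq)
  ultimately show ?thesis using LIMSEQ_unique[OF tendsto_const[of 0]] by simp
qed

text \<open>\<open>ennreal\<close> truncates at 0, so the two densities \<open>f\<close> and
  \<open>- f\<close> stand for the positive and negative parts. Their measures agree on boxes, an
  intersection-stable generator, hence everywhere, and uniqueness of densities equates the two
  parts.\<close>

lemma AE_zero_of_box_integrals:
  fixes f :: "'a::euclidean_space \<Rightarrow> real"
  assumes int: "integrable lborel f"
    and box: "\<And>a b. (\<integral>x. f x * indicat_real (box a b) x \<partial>lborel) = 0"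
  shows "AE x in lborel. f x = 0"
proof -
  have [measurable]: "f \<in> borel_measurable borel" using borel_measurable_integrable[OF int] by simp
  have eq: "emeasure (density lborel (\<lambda>x. ennreal (f x))) (box a b) = emeasure (density lborel (\<lambda>x. ennreal (- f x))) (box a b)"
    and fin: "emeasure (density lborel (\<lambda>x. ennreal (f x))) (box a b) < \<infinity>" for a b
  proof -
    have e: "emeasure (density lborel (\<lambda>x. ennreal (g x))) (box a b) = ennreal (\<integral>x. max 0 (g x) * indicat_real (box a b) x \<partial>lborel)"
      if "integrable lborel g" for g :: "'a \<Rightarrow> real"
    proof -
      have [measurable]: "g \<in> borel_measurable borel" using borel_measurable_integrable[OF that] by simp
      have "emeasure (density lborel (\<lambda>x. ennreal (g x))) (box a b) = (\<integral>\<^sup>+x. ennreal (max 0 (g x) * indicat_real (box a b) x) \<partial>lborel)"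
        by (subst emeasure_density) (auto intro!: nn_integral_cong simp: indicator_def max_def ennreal_neg)
      also have "\<dots> = ennreal (\<integral>x. max 0 (g x) * indicat_real (box a b) x \<partial>lborel)"
        by (intro nn_integral_eq_integral integrable_real_mult_indicator integrable_max that) auto
      finally show ?thesis .
    qed
    have i: "integrable lborel (\<lambda>x. max 0 (g x) * indicat_real (box a b) x)" if "integrable lborel g" for g :: "'a \<Rightarrow> real"
      by (intro integrable_real_mult_indicator integrable_max that) auto
    have "(\<integral>x. max 0 (f x) * indicat_real (box a b) x \<partial>lborel) - (\<integral>x. max 0 (- f x) * indicat_real (box a b) x \<partial>lborel)
       = (\<integral>x. f x * indicat_real (box a b) x \<partial>lborel)"
    proof -
      have "max 0 (f x) * t - max 0 (- f x) * t = f x * t" for x t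
        by (simp add: max_def)
      then show ?thesis
        using Bochner_Integration.integral_diff[OF i[OF int] i[of "\<lambda>x. - f x"]] int by simp
    qed
    then show "emeasure (density lborel (\<lambda>x. ennreal (f x))) (box a b) = emeasure (density lborel (\<lambda>x. ennreal (- f x))) (box a b)"
      using e[OF int] e[of "\<lambda>x. - f x"] int box by simp
    show "emeasure (density lborel (\<lambda>x. ennreal (f x))) (box a b) < \<infinity>" using e[OF int] by simp
  qed
  let ?E = "range (\<lambda>(a, b). box a b :: 'a set)"
  let ?A = "\<lambda>n::nat. box (- (real n *\<^sub>R One)) (real n *\<^sub>R One) :: 'a set"
  have "density lborel (\<lambda>x. ennreal (f x)) = density lborel (\<lambda>x. ennreal (- f x))"
  proof (rule measure_eqI_generator_eq)
    show "Int_stable ?E" by (auto simp: Int_stable_def box_Int_box)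
    show "?E \<subseteq> Pow UNIV" "sets (density lborel (\<lambda>x. ennreal (f x))) = sigma_sets UNIV ?E"
      "sets (density lborel (\<lambda>x. ennreal (- f x))) = sigma_sets UNIV ?E"
      by (simp_all add: borel_eq_box)
    show "range ?A \<subseteq> ?E" "(\<Union>i. ?A i) = UNIV"
      unfolding UN_box_eq_UNIV by auto
    show "emeasure (density lborel (\<lambda>x. ennreal (f x))) (?A i) \<noteq> \<infinity>" for i using fin less_imp_neq by blast
    fix X assume "X \<in> ?E"
    then show "emeasure (density lborel (\<lambda>x. ennreal (f x))) X = emeasure (density lborel (\<lambda>x. ennreal (- f x))) X"
      using eq by auto
  qed
  then have "AE x in lborel. ennreal (f x) = ennreal (- f x)"
    by (intro sigma_finite_measure.density_unique[OF lborel.sigma_finite_measure_axioms]) auto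
  then show ?thesis
  proof eventually_elim
    case (elim x)
    then show ?case by (cases "f x \<ge> 0"; cases "f x \<le> 0") (auto simp: ennreal_neg)
  qed
qed

lemma gauss_fourier_injective:
  fixes \<phi> :: "real ^ 'm::finite \<Rightarrow> complex"
  assumes int: "integrable gauss_measure \<phi>"
    and four: "\<And>\<eta>. (\<integral>x. \<phi> x * exp (\<i> * of_real (\<eta> \<bullet> x)) \<partial>gauss_measure) = 0"
  shows "AE x in gauss_measure. \<phi> x = 0"
proof -
  have phim [measurable]: "\<phi> \<in> borel_measurable borel" using borel_measurable_integrable[OF int] by simp
  define F where "F x = gauss_density x *\<^sub>R \<phi> x" for x
  have F: "integrable lborel F" using int by (subst (asm) integrable_gauss_iff) (auto simp: F_def[abs_def])
  have "(\<integral>x. F x * exp (\<i> * of_real (\<eta> \<bullet> x)) \<partial>lborel) = 0" for \<eta>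
    using four[of \<eta>] by (subst (asm) integral_gauss) (auto simp: F_def)
  then have box: "(\<integral>x. F x * of_real (indicat_real (box a b) x) \<partial>lborel) = 0" for a b
    by (rule integral_box_zero[OF F])
  have i: "integrable lborel (\<lambda>x. F x * of_real (indicat_real (box a b) x))" for a b
    by (rule Bochner_Integration.integrable_bound[OF F]) (auto simp: F_def[abs_def] norm_mult indicator_def)
  have "AE x in lborel. Re (F x) = 0"
  proof (rule AE_zero_of_box_integrals)
    show "integrable lborel (\<lambda>x. Re (F x))" using F by (rule integrable_Re)
    show "(\<integral>x. Re (F x) * indicat_real (box a b) x \<partial>lborel) = 0" for a b
      using integral_Re[OF i, of a b] box[of a b] by simp
  qed
  moreover have "AE x in lborel. Im (F x) = 0"
  proof (rule AE_zero_of_box_integrals)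
    show "integrable lborel (\<lambda>x. Im (F x))" using F by (rule integrable_Im)
    show "(\<integral>x. Im (F x) * indicat_real (box a b) x \<partial>lborel) = 0" for a b
      using integral_Im[OF i, of a b] box[of a b] by simp
  qed
  ultimately show ?thesis
    unfolding AE_gauss_measure
  proof eventually_elim
    case (elim x)
    then have "F x = 0" by (simp add: complex_eq_iff)
    then show ?case using gauss_density_pos[of x] by (simp add: F_def)
  qed
qed

section \<open>Uniqueness\<close>

text \<open>Lets the rate of decay be lowered, which reduces the supercritical case to the critical
  one.\<close>

lemma l2_norm_weight_imp_l2:
  fixes \<phi> :: "real ^ 'm::finite \<Rightarrow> complex"
  assumes "\<phi> \<in> l2_space gauss_measure" "a \<le> b"
    and "l2_norm gauss_measure (\<lambda>x. complex_of_real (exp (b * (norm x)\<^sup>2)) * \<phi> x) < \<infinity>"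
  shows "(\<lambda>x. complex_of_real (exp (a * (norm x)\<^sup>2)) * \<phi> x) \<in> l2_space gauss_measure"
proof (rule l2_spaceI_bounded[where C = 1])
  have [measurable]: "\<phi> \<in> borel_measurable borel" using l2_space_measurable[OF assms(1)] by simp
  show "(\<lambda>x. complex_of_real (exp (b * (norm x)\<^sup>2)) * \<phi> x) \<in> l2_space gauss_measure"
    using assms(3) by (simp add: l2_space_def)
  show "(\<lambda>x. complex_of_real (exp (a * (norm x)\<^sup>2)) * \<phi> x) \<in> borel_measurable gauss_measure" by simp
  show "cmod (complex_of_real (exp (a * (norm x)\<^sup>2)) * \<phi> x)
      \<le> 1 * cmod (complex_of_real (exp (b * (norm x)\<^sup>2)) * \<phi> x)" for x
    using assms(2) by (simp add: norm_mult mult_right_mono)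
qed

theorem proposition1p5:
  fixes U :: "real \<Rightarrow> (real ^ 'm::finite \<Rightarrow> complex) \<Rightarrow> (real ^ 'm \<Rightarrow> complex)"
    and \<phi> :: "real ^ 'm \<Rightarrow> complex"
    and f :: "real ^ 'm \<Rightarrow> real \<Rightarrow> complex"
    and a b s :: real
  assumes "is_exp_it gauss_measure ou_operator U"
    and "\<phi> \<in> l2_space gauss_measure"
    and "f = (\<lambda>x t. U t \<phi> x)"
    and "a > 0" and "b > 0"
    and "l2_norm gauss_measure (\<lambda>x. complex_of_real (exp (a * (norm x)\<^sup>2)) * f x 0)
       + l2_norm gauss_measure (\<lambda>x. complex_of_real (exp (b * (norm x)\<^sup>2)) * f x s) < \<infinity>"
    and "a * b * (sin s)\<^sup>2 \<ge> 1 / 16"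
  shows "\<forall>t. AE x in gauss_measure. f x t = 0"
proof
  fix t
  note U = assms(1) and phi = assms(2)
  have un: "l2_unitary gauss_measure (U t)" for t
    using U by (simp add: is_exp_it_def unitary_group_def)
  then have Ul2: "U t \<phi> \<in> l2_space gauss_measure" for t
    using phi by (auto simp: l2_unitary_def)
  have sin0: "(sin s)\<^sup>2 > 0"
    using assms(7) by (cases "sin s = 0") auto
  \<comment> \<open>The rate at which the hypothesis on \<open>a * b\<close> becomes an
    equality.\<close>
  define a' where "a' = 1 / (16 * b * (sin s)\<^sup>2)"
  have a': "a' > 0" "a' \<le> a" "16 * a' * b * (sin s)\<^sup>2 = 1"
    using assms(5,7) sin0 by (auto simp: a'_def field_simps)
  have fin: "l2_norm gauss_measure (\<lambda>x. complex_of_real (exp (a * (norm x)\<^sup>2)) * U 0 \<phi> x) < \<infinity>"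
     "l2_norm gauss_measure (\<lambda>x. complex_of_real (exp (b * (norm x)\<^sup>2)) * U s \<phi> x) < \<infinity>"
    using assms(6) unfolding assms(3) by (auto simp: less_top)
  note w0 = l2_norm_weight_imp_l2[OF Ul2 a'(2) fin(1)]
  note ws = l2_norm_weight_imp_l2[OF Ul2 order_refl fin(2)]
  define \<alpha> where "\<alpha> = 1 / (4 * a' + 1)"
  define \<beta> where "\<beta> = 1 / (4 * b + 1)"
  have al: "0 < \<alpha>" "\<alpha> < 1" and be: "0 < \<beta>" "\<beta> < 1"
    using a' assms(5) by (auto simp: \<alpha>_def \<beta>_def)
  have crit: "(1 - \<alpha>) * (1 - \<beta>) * (sin s)\<^sup>2 = \<alpha> * \<beta>"
  proof -
    have "1 - \<alpha> = 4 * a' * \<alpha>" "1 - \<beta> = 4 * b * \<beta>"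
      using a'(1) assms(5) by (auto simp: \<alpha>_def \<beta>_def field_simps)
    then have "(1 - \<alpha>) * (1 - \<beta>) * (sin s)\<^sup>2 = (16 * a' * b * (sin s)\<^sup>2) * (\<alpha> * \<beta>)" by (simp add: mult_ac)
    then show ?thesis by (simp only: a'(3) mult_1)
  qed
  have zero: "(\<integral>x. U 0 \<phi> x * gauss_exp w l x \<partial>gauss_measure) = 0" if w: "norm w = 1" for w :: "real ^ 'm" and l
  proof -
    obtain J C where J: "\<And>r. J r \<le> C" "\<And>c. c \<noteq> 0 \<Longrightarrow> (\<lambda>n. J (real n * c)) \<longlonglongrightarrow> 0"
      "\<And>l. cmod (\<integral>x. U 0 \<phi> x * gauss_exp w l x \<partial>gauss_measure)
         \<le> J (Re l) * exp (\<alpha> * (Re l)\<^sup>2 - Re (l\<^sup>2) / 2)"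
      by (rule gaussian_transform_bound[OF a'(1) w Ul2 w0, folded \<alpha>_def]) (rule that)
    obtain J' C' where J': "\<And>r. J' r \<le> C'" "\<And>c. c \<noteq> 0 \<Longrightarrow> (\<lambda>n. J' (real n * c)) \<longlonglongrightarrow> 0"
      "\<And>l. cmod (\<integral>x. U s \<phi> x * gauss_exp w l x \<partial>gauss_measure)
         \<le> J' (Re l) * exp (\<beta> * (Re l)\<^sup>2 - Re (l\<^sup>2) / 2)"
      by (rule gaussian_transform_bound[OF assms(5) w Ul2 ws, folded \<beta>_def]) (rule that)
    show ?thesis
    proof (rule hardy_entire_zero[OF holomorphic_gauss_exp_transform[OF Ul2 w] al be crit J])
      fix l
      have "(\<integral>x. U 0 \<phi> x * gauss_exp w l x \<partial>gauss_measure) = (\<integral>x. U s \<phi> x * gauss_exp w (cis s * l) x \<partial>gauss_measure)"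
        using gauss_exp_evolution[OF U phi w, of s l] by (simp add: cis_conv_exp)
      then show "cmod (\<integral>x. U 0 \<phi> x * gauss_exp w l x \<partial>gauss_measure)
          \<le> C' * exp (\<beta> * (Re (cis s * l))\<^sup>2 - Re ((cis s * l)\<^sup>2) / 2)"
        by (auto intro!: order_trans[OF J'(3)] mult_right_mono J'(1))
    qed
  qed
  have "AE x in gauss_measure. U 0 \<phi> x = 0"
  proof (rule gauss_fourier_injective)
    have "(\<lambda>x. 1) \<in> l2_space (gauss_measure :: (real ^ 'm) measure)"
      by (rule l2_space_gauss_exp_bound[where C = 1 and c = 0]) auto
    from l2_inner_integrable[OF Ul2 this] show "integrable gauss_measure (U 0 \<phi>)" by simp
    fix \<eta> :: "real ^ 'm"
    obtain w :: "real ^ 'm" where w: "norm w = 1" "\<eta> = norm \<eta> *\<^sub>R w"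
    proof (cases "\<eta> = 0")
      case True
      \<comment> \<open>At frequency 0 any unit vector will do.\<close>
      then show ?thesis using that[of "axis undefined 1"] by simp
    next
      case False
      then show ?thesis using that[of "\<eta> /\<^sub>R norm \<eta>"] by simp
    qed
    \<comment> \<open>At an imaginary parameter the exponential is a character times the constant
      \<open>exp (- ?l\<^sup>2 / 2)\<close>.\<close>
    let ?l = "\<i> * of_real (norm \<eta>)"
    have "exp (\<i> * of_real (\<eta> \<bullet> x)) = exp (?l\<^sup>2 / 2) * gauss_exp w ?l x" for x
    proof -
      have "\<eta> \<bullet> x = norm \<eta> * (w \<bullet> x)" by (subst w(2)) simp
      then show ?thesis by (simp add: gauss_exp_def mult.assoc flip: exp_add)
    qed
    then have "(\<integral>x. U 0 \<phi> x * exp (\<i> * of_real (\<eta> \<bullet> x)) \<partial>gauss_measure)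
       = exp (?l\<^sup>2 / 2) * (\<integral>x. U 0 \<phi> x * gauss_exp w ?l x \<partial>gauss_measure)"
      by (simp only: mult.left_commute[of "U 0 \<phi> _"] integral_mult_right_zero)
    then show "(\<integral>x. U 0 \<phi> x * exp (\<i> * of_real (\<eta> \<bullet> x)) \<partial>gauss_measure) = 0"
      by (simp only: zero[OF w(1)] mult_zero_right)
  qed
  \<comment> \<open>Vanishing at time 0 passes to \<phi> and then, by preservation of the norm, to
    every time \<open>t\<close>.\<close>
  moreover have "AE x in gauss_measure. U 0 \<phi> x = \<phi> x"
    using U phi by (simp add: is_exp_it_def unitary_group_def)
  ultimately have "AE x in gauss_measure. ennreal ((cmod (\<phi> x))\<^sup>2) = 0"
    by eventually_elim simp
  then have "sq_int gauss_measure \<phi> = 0"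
    using l2_space_measurable[OF phi] by (subst nn_integral_0_iff_AE) auto
  then have "sq_int gauss_measure (U t \<phi>) = 0" by (simp add: sq_int_unitary[OF un phi])
  then have "AE x in gauss_measure. ennreal ((cmod (U t \<phi> x))\<^sup>2) = 0"
    using l2_space_measurable[OF Ul2] by (subst (asm) nn_integral_0_iff_AE) auto
  then show "AE x in gauss_measure. f x t = 0"
    unfolding assms(3) by eventually_elim (simp add: ennreal_eq_0_iff)
qed

end
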